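(* Let $\mathcal{Q}$ be a seminormal quasi-crystal with underlying set $Q$ such that $\{ \mathrm{wt}(x) : x \in Q \}$ is a linearly independent set. Then ${\approx} \subseteq {\ddot{\sim}}$, where $\approx$ and $\ddot{\sim}$ are the plactic and the hypoplactic congruences on $Q^*$ associated to $\mathcal{Q}$. Therefore, the hypoplactic monoid $\mathrm{hypo}(\mathcal{Q})$ is a monoid quotient of the plactic monoid $\mathrm{plac}(\mathcal{Q})$.
   Context: Root data. Let $V$ be a Euclidean space with inner product $\langle\cdot,\cdot\rangle$; for nonzero $\alpha \in V$ put $\alpha^\vee = \frac{2}{\langle\alpha,\alpha\rangle}\alpha$ and $r_\alpha(v) = v - \langle v,\alpha^\vee\rangle\alpha$. A root system $\Phi \subseteq V$ is a nonempty finite subset with $0 \notin \Phi$, $r_\alpha(\beta) \in \Phi$ and $\langle\alpha,\beta^\vee\rangle \in \mathbb{Z}$ for all $\alpha,\beta\in\Phi$, and such that $\alpha, k\alpha \in \Phi$ implies $k = \pm 1$. Fix simple roots $(\alpha_i)_{i\in I}$ (linearly independent roots such that every root is an integer combination of them with coefficients all nonnegative or all nonpositive) and a weight lattice $\Lambda$ (a $\mathbb{Z}$-submodule of $V$ spanning $V$, containing $\Phi$, with $\langle\lambda,\alpha^\vee\rangle\in\mathbb{Z}$ for all $\lambda\in\Lambda$, $\alpha\in\Phi$). Linear independence of weights is in the real vector space $V$. Conventions. In $\mathbb{Z}\cup\{+\infty\}$, $m < +\infty$ and $m + (+\infty) = (+\infty) + m = +\infty$ for all $m\in\mathbb{Z}$.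 The symbol $\bot$ is an auxiliary symbol meaning "undefined". Seminormal quasi-crystals. A seminormal quasi-crystal $\mathcal{Q}$ of type $\Phi$ is a set $Q$ with maps $\mathrm{wt}: Q\to\Lambda$, $\ddot e_i,\ddot f_i : Q\to Q\sqcup\{\bot\}$, $\ddot\varepsilon_i,\ddot\varphi_i: Q\to\mathbb{Z}\cup\{+\infty\}$ ($i\in I$) such that for all $x,y\in Q$, $i\in I$: (1) $\ddot\varphi_i(x) = \ddot\varepsilon_i(x) + \langle\mathrm{wt}(x),\alpha_i^\vee\rangle$; (2) if $\ddot e_i(x)\in Q$ then $\mathrm{wt}(\ddot e_i(x)) = \mathrm{wt}(x)+\alpha_i$; (3) if $\ddot f_i(x)\in Q$ then $\mathrm{wt}(\ddot f_i(x)) = \mathrm{wt}(x)-\alpha_i$; (4) $\ddot e_i(x)=y$ iff $x=\ddot f_i(y)$; (5) if $\ddot\varepsilon_i(x)=+\infty$ then $\ddot e_i(x)=\ddot f_i(x)=\bot$; (6) if $\ddot\varepsilon_i(x)\neq+\infty$ then $\ddot\varepsilon_i(x)=\max\{k\in\mathbb{Z}_{\ge0} : \ddot e_i^k(x)\in Q\}$ and $\ddot\varphi_i(x)=\max\{k\in\mathbb{Z}_{\ge0} : \ddot f_i^k(x)\in Q\}$. Homomorphisms. A quasi-crystal homomorphism $\psi:\mathcal{Q}\to\mathcal{Q}'$ (same type) is a map $\psi: Q\sqcup\{\bot\}\to Q'\sqcup\{\bot\}$ with $\psi(\bot)=\bot$ and, for $x\in Q$, $i\in I$: if $\psi(x)\in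 Q'$ then $\mathrm{wt}(\psi(x))=\mathrm{wt}(x)$, $\ddot\varepsilon_i(\psi(x))=\ddot\varepsilon_i(x)$, $\ddot\varphi_i(\psi(x))=\ddot\varphi_i(x)$; if $\ddot e_i(x)\in Q$ and $\psi(x),\psi(\ddot e_i(x))\in Q'$ then $\psi(\ddot e_i(x))=\ddot e_i(\psi(x))$; and likewise with $\ddot f_i$ in place of $\ddot e_i$. A bijective quasi-crystal homomorphism is called a quasi-crystal isomorphism. Connected components. The quasi-crystal graph of $\mathcal{Q}$ has vertex set $Q$, an edge labelled $i$ from $x$ to $y$ whenever $\ddot f_i(x)=y$, and a loop labelled $i$ at $x$ whenever $\ddot\varepsilon_i(x)=+\infty$. For $x\in Q$, $\mathcal{Q}(x)$ denotes the seminormal quasi-crystal obtained by restricting the structure of $\mathcal{Q}$ to the vertex set of the connected component (ignoring edge directions) of this graph containing $x$. Free $\otimes$-quasi-crystal monoid. $\mathcal{Q}^{\otimes}$ is the set $Q^*$ of all words over $Q$ (with concatenation and empty word $\epsilon$) with the following seminormal quasi-crystal structure: on letters it agrees with that of $\mathcal{Q}$; $\mathrm{wt}(\epsilon)=0$, $\ddot e_i(\epsilon)=\ddot f_i(\epsilon)=\bot$, $\ddot\varepsilon_i(\epsilon)=\ddot\varphi_i(\epsilon)=0$; and for $u,v\in Q^*$: $\mathrm{wt}(uv)=\mathrm{wt}(u)+\mathrm{wt}(v)$; $\ddot e_i(uv)=\ddot e_i(u)v$ if $\ddot\varphi_i(u)\ge\ddot\varepsilon_i(v)$, and $u\,\ddot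 e_i(v)$ if $\ddot\varphi_i(u)<\ddot\varepsilon_i(v)$; $\ddot f_i(uv)=\ddot f_i(u)v$ if $\ddot\varphi_i(u)>\ddot\varepsilon_i(v)$, and $u\,\ddot f_i(v)$ if $\ddot\varphi_i(u)\le\ddot\varepsilon_i(v)$; $\ddot\varepsilon_i(uv)=\max\{\ddot\varepsilon_i(u),\ddot\varepsilon_i(v)-\langle\mathrm{wt}(u),\alpha_i^\vee\rangle\}$; $\ddot\varphi_i(uv)=\max\{\ddot\varphi_i(u)+\langle\mathrm{wt}(v),\alpha_i^\vee\rangle,\ddot\varphi_i(v)\}$; here $u\bot=\bot v=\bot$. (This is well defined.) Free $\ddot\otimes$-quasi-crystal monoid. $\mathcal{Q}^{\ddot\otimes}$ is the set $Q^*$ with the seminormal quasi-crystal structure that agrees with that of $\mathcal{Q}$ on letters, has $\mathrm{wt}(\epsilon)=0$, $\ddot e_i(\epsilon)=\ddot f_i(\epsilon)=\bot$, $\ddot\varepsilon_i(\epsilon)=\ddot\varphi_i(\epsilon)=0$, has $\mathrm{wt}(uv)=\mathrm{wt}(u)+\mathrm{wt}(v)$, and for $u,v\in Q^*$: if $\ddot\varphi_i(u)>0$ and $\ddot\varepsilon_i(v)>0$, then $\ddot e_i(uv)=\ddot f_i(uv)=\bot$ and $\ddot\varepsilon_i(uv)=\ddot\varphi_i(uv)=+\infty$; otherwise $\ddot e_i(uv),\ddot f_i(uv),\ddot\varepsilon_i(uv),\ddot\varphi_i(uv)$ are given by the same formulas as for $\mathcal{Q}^{\otimes}$, applied to the structure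 maps of $\mathcal{Q}^{\ddot\otimes}$. (This is well defined.) Congruences and monoids. For $u,v\in Q^*$: $u\approx v$ iff there is a quasi-crystal isomorphism $\psi:\mathcal{Q}^{\otimes}(u)\to\mathcal{Q}^{\otimes}(v)$ with $\psi(u)=v$ (plactic congruence); $u\mathrel{\ddot\sim}v$ iff there is a quasi-crystal isomorphism $\psi:\mathcal{Q}^{\ddot\otimes}(u)\to\mathcal{Q}^{\ddot\otimes}(v)$ with $\psi(u)=v$ (hypoplactic congruence). Both relations are monoid congruences on the free monoid $Q^*$ (known facts). The plactic monoid is $\mathrm{plac}(\mathcal{Q})=Q^*/{\approx}$ and the hypoplactic monoid is $\mathrm{hypo}(\mathcal{Q})=Q^*/{\ddot\sim}$. *)

theory Defs
  imports "HOL-Analysis.Analysis" "HOL-Library.Extended" "HOL-Algebra.Group"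
begin

section \<open>Root data\<close>

definition coroot :: "'v::euclidean_space \<Rightarrow> 'v"
  where "coroot a = (2 / (a \<bullet> a)) *\<^sub>R a"

definition reflection :: "'v::euclidean_space \<Rightarrow> 'v \<Rightarrow> 'v"
  where "reflection a v = v - (v \<bullet> coroot a) *\<^sub>R a"

text \<open>The floor only serves to read the real number \<open>v \<bullet> coroot a\<close> as an element of \<open>int\<close>:
  it is an integer whenever \<open>v\<close> is a weight and \<open>a\<close> a root.\<close>

definition pairing :: "'v::euclidean_space \<Rightarrow> 'v \<Rightarrow> int"
  where "pairing v a = \<lfloor>v \<bullet> coroot a\<rfloor>"

locale root_system =
  fixes \<Phi> :: "'v::euclidean_space set"
  assumes finite_roots: "finite \<Phi>"
    and roots_nonempty: "\<Phi> \<noteq> {}"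
    and zero_not_root: "0 \<notin> \<Phi>"
    and reflection_root: "\<lbrakk>a \<in> \<Phi>; b \<in> \<Phi>\<rbrakk> \<Longrightarrow> reflection a b \<in> \<Phi>"
    and root_integral: "\<lbrakk>a \<in> \<Phi>; b \<in> \<Phi>\<rbrakk> \<Longrightarrow> a \<bullet> coroot b \<in> \<int>"
    and root_reduced: "\<lbrakk>a \<in> \<Phi>; k *\<^sub>R a \<in> \<Phi>\<rbrakk> \<Longrightarrow> k = 1 \<or> k = -1"

text \<open>The index set of the simple roots is the type \<open>'i\<close>.  It is automatically nonempty (as
  \<open>\<Phi>\<close> is) and finite (as the simple roots are linearly independent), so the sort \<open>finite\<close> is no
  restriction.\<close>

locale root_datum = root_system \<Phi>
  for \<Phi> :: "'v::euclidean_space set" +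
  fixes \<alpha> :: "'i::finite \<Rightarrow> 'v"
    and \<Lambda> :: "'v set"
  assumes simple_root: "\<alpha> i \<in> \<Phi>"
    and simple_inj: "inj \<alpha>"
    and simple_independent: "independent (range \<alpha>)"
    and simple_expansion: "b \<in> \<Phi> \<Longrightarrow> \<exists>c :: 'i \<Rightarrow> int.
          b = (\<Sum>i\<in>UNIV. of_int (c i) *\<^sub>R \<alpha> i) \<and> ((\<forall>i. c i \<ge> 0) \<or> (\<forall>i. c i \<le> 0))"
    and weight_zero: "0 \<in> \<Lambda>"
    and weight_add: "\<lbrakk>l \<in> \<Lambda>; m \<in> \<Lambda>\<rbrakk> \<Longrightarrow> l + m \<in> \<Lambda>"
    and weight_scale: "l \<in> \<Lambda> \<Longrightarrow> of_int n *\<^sub>R l \<in> \<Lambda>"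
    and weight_span: "span \<Lambda> = UNIV"
    and roots_weights: "\<Phi> \<subseteq> \<Lambda>"
    and weight_integral: "\<lbrakk>l \<in> \<Lambda>; a \<in> \<Phi>\<rbrakk> \<Longrightarrow> l \<bullet> coroot a \<in> \<int>"

section \<open>Seminormal quasi-crystals\<close>

text \<open>\<open>None\<close> plays the role of \<open>\<bottom>\<close>.  In \<open>int extended\<close> only \<open>Fin\<close> and \<open>Pinf\<close> are used; the third
  constructor \<open>Minf\<close> is excluded in the locale below.\<close>

record ('q, 'i, 'v) qcrystal =
  elems :: "'q set"
  wt :: "'q \<Rightarrow> 'v"
  eop :: "'i \<Rightarrow> 'q \<Rightarrow> 'q option"
  fop :: "'i \<Rightarrow> 'q \<Rightarrow> 'q option"
  eps :: "'i \<Rightarrow> 'q \<Rightarrow> int extended"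
  phi :: "'i \<Rightarrow> 'q \<Rightarrow> int extended"

definition iter_op :: "('q \<Rightarrow> 'q option) \<Rightarrow> nat \<Rightarrow> 'q \<Rightarrow> 'q option"
  where "iter_op g k x = ((\<lambda>z. Option.bind z g) ^^ k) (Some x)"

locale seminormal_quasi_crystal = root_datum \<Phi> \<alpha> \<Lambda>
  for \<Phi> :: "'v::euclidean_space set"
    and \<alpha> :: "'i::finite \<Rightarrow> 'v"
    and \<Lambda> :: "'v set" +
  fixes Q :: "('q, 'i, 'v) qcrystal"
  assumes wt_in: "x \<in> elems Q \<Longrightarrow> wt Q x \<in> \<Lambda>"
    and eop_closed: "\<lbrakk>x \<in> elems Q; eop Q i x = Some y\<rbrakk> \<Longrightarrow> y \<in> elems Q"
    and fop_closed: "\<lbrakk>x \<in> elems Q; fop Q i x = Some y\<rbrakk> \<Longrightarrow> y \<in> elems Q"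
    and eps_range: "x \<in> elems Q \<Longrightarrow> eps Q i x \<noteq> Minf"
    and phi_range: "x \<in> elems Q \<Longrightarrow> phi Q i x \<noteq> Minf"
    and phi_eps: "x \<in> elems Q \<Longrightarrow> phi Q i x = eps Q i x + Fin (pairing (wt Q x) (\<alpha> i))"
    and wt_eop: "\<lbrakk>x \<in> elems Q; eop Q i x = Some y\<rbrakk> \<Longrightarrow> wt Q y = wt Q x + \<alpha> i"
    and wt_fop: "\<lbrakk>x \<in> elems Q; fop Q i x = Some y\<rbrakk> \<Longrightarrow> wt Q y = wt Q x - \<alpha> i"
    and eop_fop: "\<lbrakk>x \<in> elems Q; y \<in> elems Q\<rbrakk> \<Longrightarrow> eop Q i x = Some y \<longleftrightarrow> fop Q i y = Some x"
    and eps_infinite: "\<lbrakk>x \<in> elems Q; eps Q i x = Pinf\<rbrakk> \<Longrightarrow> eop Q i x = None \<and> fop Q i x = None"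
    and eps_finite: "\<lbrakk>x \<in> elems Q; eps Q i x \<noteq> Pinf\<rbrakk> \<Longrightarrow>
          finite {k. iter_op (eop Q i) k x \<noteq> None} \<and>
          eps Q i x = Fin (int (Max {k. iter_op (eop Q i) k x \<noteq> None}))"
    and phi_finite: "\<lbrakk>x \<in> elems Q; eps Q i x \<noteq> Pinf\<rbrakk> \<Longrightarrow>
          finite {k. iter_op (fop Q i) k x \<noteq> None} \<and>
          phi Q i x = Fin (int (Max {k. iter_op (fop Q i) k x \<noteq> None}))"

section \<open>Homomorphisms and connected components\<close>

definition pointed :: "('q, 'i, 'v) qcrystal \<Rightarrow> 'q option set"
  where "pointed Q = insert None (Some ` elems Q)"

definition qc_hom ::
    "('q, 'i, 'v) qcrystal \<Rightarrow> ('r, 'i, 'v) qcrystal \<Rightarrow> ('q option \<Rightarrow> 'r option) \<Rightarrow> bool"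
  where "qc_hom Q Q' \<psi> \<longleftrightarrow>
    \<psi> ` pointed Q \<subseteq> pointed Q' \<and> \<psi> None = None \<and>
    (\<forall>x\<in>elems Q. \<forall>i y. \<psi> (Some x) = Some y \<longrightarrow>
        wt Q' y = wt Q x \<and> eps Q' i y = eps Q i x \<and> phi Q' i y = phi Q i x) \<and>
    (\<forall>x\<in>elems Q. \<forall>i x' y y'.
        eop Q i x = Some x' \<and> \<psi> (Some x) = Some y \<and> \<psi> (Some x') = Some y' \<longrightarrow>
        eop Q' i y = Some y') \<and>
    (\<forall>x\<in>elems Q. \<forall>i x' y y'.
        fop Q i x = Some x' \<and> \<psi> (Some x) = Some y \<and> \<psi> (Some x') = Some y' \<longrightarrow>
        fop Q' i y = Some y')"

definition qc_iso ::
    "('q, 'i, 'v) qcrystal \<Rightarrow> ('r, 'i, 'v) qcrystal \<Rightarrow> ('q option \<Rightarrow> 'r option) \<Rightarrow> bool"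
  where "qc_iso Q Q' \<psi> \<longleftrightarrow> qc_hom Q Q' \<psi> \<and> bij_betw \<psi> (pointed Q) (pointed Q')"

definition qc_graph :: "('q, 'i, 'v) qcrystal \<Rightarrow> ('q \<times> 'i \<times> 'q) set"
  where "qc_graph Q =
    {(x, i, y). x \<in> elems Q \<and> y \<in> elems Q \<and> (fop Q i x = Some y \<or> (x = y \<and> eps Q i x = Pinf))}"

definition component_set :: "('q, 'i, 'v) qcrystal \<Rightarrow> 'q \<Rightarrow> 'q set"
  where "component_set Q x =
    {y \<in> elems Q. (x, y) \<in> {(a, b). \<exists>i. (a, i, b) \<in> qc_graph Q \<or> (b, i, a) \<in> qc_graph Q}\<^sup>*}"

definition component :: "('q, 'i, 'v) qcrystal \<Rightarrow> 'q \<Rightarrow> ('q, 'i, 'v) qcrystal"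
  where "component Q x = Q\<lparr>elems := component_set Q x\<rparr>"

section \<open>The two quasi-crystal structures on words\<close>

text \<open>The structure maps are obtained by splitting off the first letter of a word, that is, by the
  defining formulas for \<open>uv\<close> with \<open>u\<close> a letter and \<open>v\<close> a nonempty word.  That the formulas then
  hold for arbitrary \<open>u\<close> and \<open>v\<close> is shown below.\<close>

definition word_wt :: "('q, 'i, 'v::euclidean_space) qcrystal \<Rightarrow> 'q list \<Rightarrow> 'v"
  where "word_wt Q w = (\<Sum>x\<leftarrow>w. wt Q x)"

fun ten_eps :: "('i \<Rightarrow> 'v::euclidean_space) \<Rightarrow> ('q, 'i, 'v) qcrystal \<Rightarrow> 'i \<Rightarrow> 'q list \<Rightarrow> int extended"
  where
    "ten_eps \<alpha> Q i [] = Fin 0"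
  | "ten_eps \<alpha> Q i [x] = eps Q i x"
  | "ten_eps \<alpha> Q i (x # y # w) =
       max (eps Q i x) (ten_eps \<alpha> Q i (y # w) - Fin (pairing (wt Q x) (\<alpha> i)))"

fun ten_phi :: "('i \<Rightarrow> 'v::euclidean_space) \<Rightarrow> ('q, 'i, 'v) qcrystal \<Rightarrow> 'i \<Rightarrow> 'q list \<Rightarrow> int extended"
  where
    "ten_phi \<alpha> Q i [] = Fin 0"
  | "ten_phi \<alpha> Q i [x] = phi Q i x"
  | "ten_phi \<alpha> Q i (x # y # w) =
       max (phi Q i x + Fin (pairing (word_wt Q (y # w)) (\<alpha> i))) (ten_phi \<alpha> Q i (y # w))"

fun ten_e :: "('i \<Rightarrow> 'v::euclidean_space) \<Rightarrow> ('q, 'i, 'v) qcrystal \<Rightarrow> 'i \<Rightarrow> 'q list \<Rightarrow> 'q list option"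
  where
    "ten_e \<alpha> Q i [] = None"
  | "ten_e \<alpha> Q i [x] = map_option (\<lambda>x'. [x']) (eop Q i x)"
  | "ten_e \<alpha> Q i (x # y # w) =
       (if phi Q i x \<ge> ten_eps \<alpha> Q i (y # w)
        then map_option (\<lambda>x'. x' # y # w) (eop Q i x)
        else map_option (\<lambda>w'. x # w') (ten_e \<alpha> Q i (y # w)))"

fun ten_f :: "('i \<Rightarrow> 'v::euclidean_space) \<Rightarrow> ('q, 'i, 'v) qcrystal \<Rightarrow> 'i \<Rightarrow> 'q list \<Rightarrow> 'q list option"
  where
    "ten_f \<alpha> Q i [] = None"
  | "ten_f \<alpha> Q i [x] = map_option (\<lambda>x'. [x']) (fop Q i x)"
  | "ten_f \<alpha> Q i (x # y # w) =
       (if phi Q i x > ten_eps \<alpha> Q i (y # w)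
        then map_option (\<lambda>x'. x' # y # w) (fop Q i x)
        else map_option (\<lambda>w'. x # w') (ten_f \<alpha> Q i (y # w)))"

definition tensor_words ::
    "('i \<Rightarrow> 'v::euclidean_space) \<Rightarrow> ('q, 'i, 'v) qcrystal \<Rightarrow> ('q list, 'i, 'v) qcrystal"
  where "tensor_words \<alpha> Q =
    \<lparr>elems = lists (elems Q), wt = word_wt Q, eop = ten_e \<alpha> Q, fop = ten_f \<alpha> Q,
     eps = ten_eps \<alpha> Q, phi = ten_phi \<alpha> Q\<rparr>"

fun qten_eps :: "('i \<Rightarrow> 'v::euclidean_space) \<Rightarrow> ('q, 'i, 'v) qcrystal \<Rightarrow> 'i \<Rightarrow> 'q list \<Rightarrow> int extended"
  where
    "qten_eps \<alpha> Q i [] = Fin 0"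
  | "qten_eps \<alpha> Q i [x] = eps Q i x"
  | "qten_eps \<alpha> Q i (x # y # w) =
       (if phi Q i x > Fin 0 \<and> qten_eps \<alpha> Q i (y # w) > Fin 0 then Pinf
        else max (eps Q i x) (qten_eps \<alpha> Q i (y # w) - Fin (pairing (wt Q x) (\<alpha> i))))"

fun qten_phi :: "('i \<Rightarrow> 'v::euclidean_space) \<Rightarrow> ('q, 'i, 'v) qcrystal \<Rightarrow> 'i \<Rightarrow> 'q list \<Rightarrow> int extended"
  where
    "qten_phi \<alpha> Q i [] = Fin 0"
  | "qten_phi \<alpha> Q i [x] = phi Q i x"
  | "qten_phi \<alpha> Q i (x # y # w) =
       (if phi Q i x > Fin 0 \<and> qten_eps \<alpha> Q i (y # w) > Fin 0 then Pinf
        else max (phi Q i x + Fin (pairing (word_wt Q (y # w)) (\<alpha> i))) (qten_phi \<alpha> Q i (y # w)))"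

fun qten_e :: "('i \<Rightarrow> 'v::euclidean_space) \<Rightarrow> ('q, 'i, 'v) qcrystal \<Rightarrow> 'i \<Rightarrow> 'q list \<Rightarrow> 'q list option"
  where
    "qten_e \<alpha> Q i [] = None"
  | "qten_e \<alpha> Q i [x] = map_option (\<lambda>x'. [x']) (eop Q i x)"
  | "qten_e \<alpha> Q i (x # y # w) =
       (if phi Q i x > Fin 0 \<and> qten_eps \<alpha> Q i (y # w) > Fin 0 then None
        else if phi Q i x \<ge> qten_eps \<alpha> Q i (y # w)
        then map_option (\<lambda>x'. x' # y # w) (eop Q i x)
        else map_option (\<lambda>w'. x # w') (qten_e \<alpha> Q i (y # w)))"

fun qten_f :: "('i \<Rightarrow> 'v::euclidean_space) \<Rightarrow> ('q, 'i, 'v) qcrystal \<Rightarrow> 'i \<Rightarrow> 'q list \<Rightarrow> 'q list option"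
  where
    "qten_f \<alpha> Q i [] = None"
  | "qten_f \<alpha> Q i [x] = map_option (\<lambda>x'. [x']) (fop Q i x)"
  | "qten_f \<alpha> Q i (x # y # w) =
       (if phi Q i x > Fin 0 \<and> qten_eps \<alpha> Q i (y # w) > Fin 0 then None
        else if phi Q i x > qten_eps \<alpha> Q i (y # w)
        then map_option (\<lambda>x'. x' # y # w) (fop Q i x)
        else map_option (\<lambda>w'. x # w') (qten_f \<alpha> Q i (y # w)))"

definition qtensor_words ::
    "('i \<Rightarrow> 'v::euclidean_space) \<Rightarrow> ('q, 'i, 'v) qcrystal \<Rightarrow> ('q list, 'i, 'v) qcrystal"
  where "qtensor_words \<alpha> Q =
    \<lparr>elems = lists (elems Q), wt = word_wt Q, eop = qten_e \<alpha> Q, fop = qten_f \<alpha> Q,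
     eps = qten_eps \<alpha> Q, phi = qten_phi \<alpha> Q\<rparr>"

section \<open>Congruences and monoids\<close>

definition component_iso_rel :: "('q, 'i, 'v) qcrystal \<Rightarrow> ('q \<times> 'q) set"
  where "component_iso_rel W =
    {(u, v). u \<in> elems W \<and> v \<in> elems W \<and>
       (\<exists>\<psi>. qc_iso (component W u) (component W v) \<psi> \<and> \<psi> (Some u) = Some v)}"

definition plactic_rel ::
    "('i \<Rightarrow> 'v::euclidean_space) \<Rightarrow> ('q, 'i, 'v) qcrystal \<Rightarrow> ('q list \<times> 'q list) set"
  where "plactic_rel \<alpha> Q = component_iso_rel (tensor_words \<alpha> Q)"

definition hypoplactic_rel ::
    "('i \<Rightarrow> 'v::euclidean_space) \<Rightarrow> ('q, 'i, 'v) qcrystal \<Rightarrow> ('q list \<times> 'q list) set"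
  where "hypoplactic_rel \<alpha> Q = component_iso_rel (qtensor_words \<alpha> Q)"

definition free_monoid :: "'q set \<Rightarrow> 'q list monoid"
  where "free_monoid A = \<lparr>carrier = lists A, mult = (@), one = []\<rparr>"

text \<open>For a monoid congruence \<open>r\<close> on \<open>M\<close> all the sets in the union below coincide, so that the
  product of the classes of \<open>a\<close> and \<open>b\<close> is the class of the product of \<open>a\<close> and \<open>b\<close>.\<close>

definition quotient_monoid :: "('a, 'm) monoid_scheme \<Rightarrow> ('a \<times> 'a) set \<Rightarrow> 'a set monoid"
  where "quotient_monoid M r =
    \<lparr>carrier = carrier M // r,
     mult = (\<lambda>A B. \<Union>a\<in>A. \<Union>b\<in>B. r `` {a \<otimes>\<^bsub>M\<^esub> b}),
     one = r `` {\<one>\<^bsub>M\<^esub>}\<rparr>"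

definition plac :: "('i \<Rightarrow> 'v::euclidean_space) \<Rightarrow> ('q, 'i, 'v) qcrystal \<Rightarrow> 'q list set monoid"
  where "plac \<alpha> Q = quotient_monoid (free_monoid (elems Q)) (plactic_rel \<alpha> Q)"

definition hypo :: "('i \<Rightarrow> 'v::euclidean_space) \<Rightarrow> ('q, 'i, 'v) qcrystal \<Rightarrow> 'q list set monoid"
  where "hypo \<alpha> Q = quotient_monoid (free_monoid (elems Q)) (hypoplactic_rel \<alpha> Q)"

section \<open>Well-definedness of the structures on words\<close>

lemma word_wt_simps [simp]:
  "word_wt Q [] = 0" "word_wt Q (x # w) = wt Q x + word_wt Q w"
  "word_wt Q (u @ v) = word_wt Q u + word_wt Q v"
  by (simp_all add: word_wt_def)

context seminormal_quasi_crystal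
begin

lemma word_wt_in: "w \<in> lists (elems Q) \<Longrightarrow> word_wt Q w \<in> \<Lambda>"
  by (induction w) (auto intro: weight_zero weight_add wt_in)

lemma pairing_add:
  assumes "l \<in> \<Lambda>" "m \<in> \<Lambda>"
  shows "pairing (l + m) (\<alpha> i) = pairing l (\<alpha> i) + pairing m (\<alpha> i)"
  using weight_integral[OF assms(1) simple_root[of i]] weight_integral[OF assms(2) simple_root[of i]]
  by (auto simp: pairing_def inner_add_left elim!: Ints_cases simp flip: of_int_add)

lemma pairing_zero [simp]: "pairing 0 a = 0"
  by (simp add: pairing_def)

lemma letter_facts:
  assumes "x \<in> elems Q"
  shows "eps Q i x \<ge> Fin 0" "phi Q i x \<ge> Fin 0"
    "phi Q i x = eps Q i x + Fin (pairing (wt Q x) (\<alpha> i))"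
    "eps Q i x = Pinf \<or> eps Q i x = Fin 0 \<Longrightarrow> eop Q i x = None"
    "phi Q i x = Pinf \<or> phi Q i x = Fin 0 \<Longrightarrow> fop Q i x = None"
proof -
  have *: "g x = None" if "finite {k. iter_op g k x \<noteq> None}" "Max {k. iter_op g k x \<noteq> None} = 0" for g
  proof (rule ccontr)
    assume "g x \<noteq> None"
    then have "1 \<in> {k. iter_op g k x \<noteq> None}" by (simp add: iter_op_def)
    from Max_ge[OF that(1) this] that(2) show False by simp
  qed
  note facts = phi_eps[OF assms, of i] eps_infinite[OF assms, of i] eps_finite[OF assms, of i]
    phi_finite[OF assms, of i]
  show "eps Q i x \<ge> Fin 0" "phi Q i x \<ge> Fin 0"
    "phi Q i x = eps Q i x + Fin (pairing (wt Q x) (\<alpha> i))"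
    using facts by (cases "eps Q i x"; simp)+
  show "eop Q i x = None" if "eps Q i x = Pinf \<or> eps Q i x = Fin 0"
    using that facts *[of "eop Q i"] by (cases "eps Q i x"; simp)
  show "fop Q i x = None" if "phi Q i x = Pinf \<or> phi Q i x = Fin 0"
    using that facts *[of "fop Q i"] by (cases "eps Q i x"; simp)
qed

lemma ten_Cons:
  assumes "x \<in> elems Q"
  shows "ten_eps \<alpha> Q i (x # w) = max (eps Q i x) (ten_eps \<alpha> Q i w - Fin (pairing (wt Q x) (\<alpha> i)))"
    and "ten_phi \<alpha> Q i (x # w) = max (phi Q i x + Fin (pairing (word_wt Q w) (\<alpha> i))) (ten_phi \<alpha> Q i w)"
    and "ten_e \<alpha> Q i (x # w) = (if phi Q i x \<ge> ten_eps \<alpha> Q i w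
          then map_option (\<lambda>x'. x' # w) (eop Q i x) else map_option (\<lambda>w'. x # w') (ten_e \<alpha> Q i w))"
    and "ten_f \<alpha> Q i (x # w) = (if phi Q i x > ten_eps \<alpha> Q i w
          then map_option (\<lambda>x'. x' # w) (fop Q i x) else map_option (\<lambda>w'. x # w') (ten_f \<alpha> Q i w))"
  using letter_facts[OF assms, of i] by (cases "eps Q i x"; cases w; simp add: max_def)+

lemma qten_Cons:
  assumes "x \<in> elems Q"
  shows "qten_eps \<alpha> Q i (x # w) = (if phi Q i x > Fin 0 \<and> qten_eps \<alpha> Q i w > Fin 0 then Pinf
          else max (eps Q i x) (qten_eps \<alpha> Q i w - Fin (pairing (wt Q x) (\<alpha> i))))"
    and "qten_phi \<alpha> Q i (x # w) = (if phi Q i x > Fin 0 \<and> qten_eps \<alpha> Q i w > Fin 0 then Pinf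
          else max (phi Q i x + Fin (pairing (word_wt Q w) (\<alpha> i))) (qten_phi \<alpha> Q i w))"
    and "qten_e \<alpha> Q i (x # w) = (if phi Q i x > Fin 0 \<and> qten_eps \<alpha> Q i w > Fin 0 then None
          else if phi Q i x \<ge> qten_eps \<alpha> Q i w
          then map_option (\<lambda>x'. x' # w) (eop Q i x) else map_option (\<lambda>w'. x # w') (qten_e \<alpha> Q i w))"
    and "qten_f \<alpha> Q i (x # w) = (if phi Q i x > Fin 0 \<and> qten_eps \<alpha> Q i w > Fin 0 then None
          else if phi Q i x > qten_eps \<alpha> Q i w
          then map_option (\<lambda>x'. x' # w) (fop Q i x) else map_option (\<lambda>w'. x # w') (qten_f \<alpha> Q i w))"
  using letter_facts[OF assms, of i] by (cases "eps Q i x"; cases w; simp add: max_def)+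

lemma ten_facts:
  assumes "w \<in> lists (elems Q)"
  shows "ten_eps \<alpha> Q i w \<ge> Fin 0 \<and> ten_phi \<alpha> Q i w \<ge> Fin 0 \<and>
    ten_phi \<alpha> Q i w = ten_eps \<alpha> Q i w + Fin (pairing (word_wt Q w) (\<alpha> i)) \<and>
    (ten_eps \<alpha> Q i w = Pinf \<or> ten_eps \<alpha> Q i w = Fin 0 \<longrightarrow> ten_e \<alpha> Q i w = None) \<and>
    (ten_phi \<alpha> Q i w = Pinf \<or> ten_phi \<alpha> Q i w = Fin 0 \<longrightarrow> ten_f \<alpha> Q i w = None)"
  using assms
proof (induction w rule: list.induct)
  case (Cons x w)
  then have x: "x \<in> elems Q" and w: "w \<in> lists (elems Q)" by auto
  show ?case
    using letter_facts[OF x, of i] Cons.IH[OF w]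
    by (cases "eps Q i x"; cases "ten_eps \<alpha> Q i w")
       (simp_all add: ten_Cons[OF x] pairing_add[OF wt_in[OF x] word_wt_in[OF w]] max_def)
qed simp

lemma qten_facts:
  assumes "w \<in> lists (elems Q)"
  shows "qten_eps \<alpha> Q i w \<ge> Fin 0 \<and> qten_phi \<alpha> Q i w \<ge> Fin 0 \<and>
    qten_phi \<alpha> Q i w = qten_eps \<alpha> Q i w + Fin (pairing (word_wt Q w) (\<alpha> i)) \<and>
    (qten_eps \<alpha> Q i w = Pinf \<or> qten_eps \<alpha> Q i w = Fin 0 \<longrightarrow> qten_e \<alpha> Q i w = None) \<and>
    (qten_phi \<alpha> Q i w = Pinf \<or> qten_phi \<alpha> Q i w = Fin 0 \<longrightarrow> qten_f \<alpha> Q i w = None)"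
  using assms
proof (induction w rule: list.induct)
  case (Cons x w)
  then have x: "x \<in> elems Q" and w: "w \<in> lists (elems Q)" by auto
  show ?case
    using letter_facts[OF x, of i] Cons.IH[OF w]
    by (cases "eps Q i x"; cases "qten_eps \<alpha> Q i w")
       (simp_all add: qten_Cons[OF x] pairing_add[OF wt_in[OF x] word_wt_in[OF w]] max_def)
qed simp

lemma ten_append_eps:
  assumes "u \<in> lists (elems Q)" "v \<in> lists (elems Q)"
  shows "ten_eps \<alpha> Q i (u @ v) =
      max (ten_eps \<alpha> Q i u) (ten_eps \<alpha> Q i v - Fin (pairing (word_wt Q u) (\<alpha> i)))"
  using assms
proof (induction u rule: list.induct)
  case Nil
  from Nil show ?case
    using ten_facts[of v i] by (cases "ten_eps \<alpha> Q i v") (auto simp: max_def)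
next
  case (Cons x u)
  then have x: "x \<in> elems Q" and u: "u \<in> lists (elems Q)" and v: "v \<in> lists (elems Q)" by auto
  note pairing = pairing_add[OF wt_in[OF x] word_wt_in[OF u]] pairing_add[OF word_wt_in[OF u] word_wt_in[OF v]]
  show ?case
    using letter_facts[OF x, of i] ten_facts[OF u, of i] ten_facts[OF v, of i]
    by (cases "eps Q i x"; cases "ten_eps \<alpha> Q i u"; cases "ten_eps \<alpha> Q i v")
       (simp_all add: ten_Cons[OF x] Cons.IH[OF u v] pairing max_def option.map_comp comp_def)
qed

lemma ten_append_phi:
  assumes "u \<in> lists (elems Q)" "v \<in> lists (elems Q)"
  shows "ten_phi \<alpha> Q i (u @ v) =
      max (ten_phi \<alpha> Q i u + Fin (pairing (word_wt Q v) (\<alpha> i))) (ten_phi \<alpha> Q i v)"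
  using assms
proof (induction u rule: list.induct)
  case Nil
  from Nil show ?case
    using ten_facts[of v i] by (cases "ten_eps \<alpha> Q i v") (auto simp: max_def)
next
  case (Cons x u)
  then have x: "x \<in> elems Q" and u: "u \<in> lists (elems Q)" and v: "v \<in> lists (elems Q)" by auto
  note pairing = pairing_add[OF wt_in[OF x] word_wt_in[OF u]] pairing_add[OF word_wt_in[OF u] word_wt_in[OF v]]
  show ?case
    using letter_facts[OF x, of i] ten_facts[OF u, of i] ten_facts[OF v, of i]
    by (cases "eps Q i x"; cases "ten_eps \<alpha> Q i u"; cases "ten_eps \<alpha> Q i v")
       (simp_all add: ten_Cons[OF x] Cons.IH[OF u v] ten_append_eps[OF u v, of i] pairing max_def option.map_comp comp_def)
qed

lemma ten_append_e:
  assumes "u \<in> lists (elems Q)" "v \<in> lists (elems Q)"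
  shows "ten_e \<alpha> Q i (u @ v) =
      (if ten_phi \<alpha> Q i u \<ge> ten_eps \<alpha> Q i v
       then map_option (\<lambda>u'. u' @ v) (ten_e \<alpha> Q i u) else map_option (\<lambda>v'. u @ v') (ten_e \<alpha> Q i v))"
  using assms
proof (induction u rule: list.induct)
  case Nil
  have [simp]: "map_option ((@) []) z = z" for z :: "'q list option"
    by (cases z) simp_all
  from Nil show ?case
    using ten_facts[of v i] by (cases "ten_eps \<alpha> Q i v") (auto simp: max_def)
next
  case (Cons x u)
  then have x: "x \<in> elems Q" and u: "u \<in> lists (elems Q)" and v: "v \<in> lists (elems Q)" by auto
  note pairing = pairing_add[OF wt_in[OF x] word_wt_in[OF u]] pairing_add[OF word_wt_in[OF u] word_wt_in[OF v]]
  have [simp]: "map_option ((@) (x # u)) z = map_option (\<lambda>w. x # u @ w) z" for z :: "'q list option"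
    by (cases z) simp_all
  show ?case
    using letter_facts[OF x, of i] ten_facts[OF u, of i] ten_facts[OF v, of i]
    by (cases "eps Q i x"; cases "ten_eps \<alpha> Q i u"; cases "ten_eps \<alpha> Q i v")
       (simp_all add: ten_Cons[OF x] Cons.IH[OF u v] ten_append_eps[OF u v, of i] pairing max_def option.map_comp comp_def)
qed

lemma ten_append_f:
  assumes "u \<in> lists (elems Q)" "v \<in> lists (elems Q)"
  shows "ten_f \<alpha> Q i (u @ v) =
      (if ten_phi \<alpha> Q i u > ten_eps \<alpha> Q i v
       then map_option (\<lambda>u'. u' @ v) (ten_f \<alpha> Q i u) else map_option (\<lambda>v'. u @ v') (ten_f \<alpha> Q i v))"
  using assms
proof (induction u rule: list.induct)
  case Nil
  have [simp]: "map_option ((@) []) z = z" for z :: "'q list option"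
    by (cases z) simp_all
  from Nil show ?case
    using ten_facts[of v i] by (cases "ten_eps \<alpha> Q i v") (auto simp: max_def)
next
  case (Cons x u)
  then have x: "x \<in> elems Q" and u: "u \<in> lists (elems Q)" and v: "v \<in> lists (elems Q)" by auto
  note pairing = pairing_add[OF wt_in[OF x] word_wt_in[OF u]] pairing_add[OF word_wt_in[OF u] word_wt_in[OF v]]
  have [simp]: "map_option ((@) (x # u)) z = map_option (\<lambda>w. x # u @ w) z" for z :: "'q list option"
    by (cases z) simp_all
  show ?case
    using letter_facts[OF x, of i] ten_facts[OF u, of i] ten_facts[OF v, of i]
    by (cases "eps Q i x"; cases "ten_eps \<alpha> Q i u"; cases "ten_eps \<alpha> Q i v")
       (simp_all add: ten_Cons[OF x] Cons.IH[OF u v] ten_append_eps[OF u v, of i] pairing max_def option.map_comp comp_def)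
qed

lemma qten_append_eps:
  assumes "u \<in> lists (elems Q)" "v \<in> lists (elems Q)"
  shows "qten_eps \<alpha> Q i (u @ v) =
      (if qten_phi \<alpha> Q i u > Fin 0 \<and> qten_eps \<alpha> Q i v > Fin 0 then Pinf
       else max (qten_eps \<alpha> Q i u) (qten_eps \<alpha> Q i v - Fin (pairing (word_wt Q u) (\<alpha> i))))"
  using assms
proof (induction u rule: list.induct)
  case Nil
  from Nil show ?case
    using qten_facts[of v i] by (cases "qten_eps \<alpha> Q i v") (auto simp: max_def)
next
  case (Cons x u)
  then have x: "x \<in> elems Q" and u: "u \<in> lists (elems Q)" and v: "v \<in> lists (elems Q)" by auto
  note pairing = pairing_add[OF wt_in[OF x] word_wt_in[OF u]] pairing_add[OF word_wt_in[OF u] word_wt_in[OF v]]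
  show ?case
    using letter_facts[OF x, of i] qten_facts[OF u, of i] qten_facts[OF v, of i]
    by (cases "eps Q i x"; cases "qten_eps \<alpha> Q i u"; cases "qten_eps \<alpha> Q i v")
       (simp_all add: qten_Cons[OF x] Cons.IH[OF u v] pairing max_def option.map_comp comp_def)
qed

lemma qten_append_phi:
  assumes "u \<in> lists (elems Q)" "v \<in> lists (elems Q)"
  shows "qten_phi \<alpha> Q i (u @ v) =
      (if qten_phi \<alpha> Q i u > Fin 0 \<and> qten_eps \<alpha> Q i v > Fin 0 then Pinf
       else max (qten_phi \<alpha> Q i u + Fin (pairing (word_wt Q v) (\<alpha> i))) (qten_phi \<alpha> Q i v))"
  using assms
proof (induction u rule: list.induct)
  case Nil
  from Nil show ?case
    using qten_facts[of v i] by (cases "qten_eps \<alpha> Q i v") (auto simp: max_def)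
next
  case (Cons x u)
  then have x: "x \<in> elems Q" and u: "u \<in> lists (elems Q)" and v: "v \<in> lists (elems Q)" by auto
  note pairing = pairing_add[OF wt_in[OF x] word_wt_in[OF u]] pairing_add[OF word_wt_in[OF u] word_wt_in[OF v]]
  show ?case
    using letter_facts[OF x, of i] qten_facts[OF u, of i] qten_facts[OF v, of i]
    by (cases "eps Q i x"; cases "qten_eps \<alpha> Q i u"; cases "qten_eps \<alpha> Q i v")
       (simp_all add: qten_Cons[OF x] Cons.IH[OF u v] qten_append_eps[OF u v, of i] pairing max_def option.map_comp comp_def)
qed

lemma qten_append_e:
  assumes "u \<in> lists (elems Q)" "v \<in> lists (elems Q)"
  shows "qten_e \<alpha> Q i (u @ v) =
      (if qten_phi \<alpha> Q i u > Fin 0 \<and> qten_eps \<alpha> Q i v > Fin 0 then None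
       else if qten_phi \<alpha> Q i u \<ge> qten_eps \<alpha> Q i v
       then map_option (\<lambda>u'. u' @ v) (qten_e \<alpha> Q i u) else map_option (\<lambda>v'. u @ v') (qten_e \<alpha> Q i v))"
  using assms
proof (induction u rule: list.induct)
  case Nil
  have [simp]: "map_option ((@) []) z = z" for z :: "'q list option"
    by (cases z) simp_all
  from Nil show ?case
    using qten_facts[of v i] by (cases "qten_eps \<alpha> Q i v") (auto simp: max_def)
next
  case (Cons x u)
  then have x: "x \<in> elems Q" and u: "u \<in> lists (elems Q)" and v: "v \<in> lists (elems Q)" by auto
  note pairing = pairing_add[OF wt_in[OF x] word_wt_in[OF u]] pairing_add[OF word_wt_in[OF u] word_wt_in[OF v]]
  have [simp]: "map_option ((@) (x # u)) z = map_option (\<lambda>w. x # u @ w) z" for z :: "'q list option"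
    by (cases z) simp_all
  show ?case
    using letter_facts[OF x, of i] qten_facts[OF u, of i] qten_facts[OF v, of i]
    by (cases "eps Q i x"; cases "qten_eps \<alpha> Q i u"; cases "qten_eps \<alpha> Q i v")
       (simp_all add: qten_Cons[OF x] Cons.IH[OF u v] qten_append_eps[OF u v, of i] pairing max_def option.map_comp comp_def)
qed

lemma qten_append_f:
  assumes "u \<in> lists (elems Q)" "v \<in> lists (elems Q)"
  shows "qten_f \<alpha> Q i (u @ v) =
      (if qten_phi \<alpha> Q i u > Fin 0 \<and> qten_eps \<alpha> Q i v > Fin 0 then None
       else if qten_phi \<alpha> Q i u > qten_eps \<alpha> Q i v
       then map_option (\<lambda>u'. u' @ v) (qten_f \<alpha> Q i u) else map_option (\<lambda>v'. u @ v') (qten_f \<alpha> Q i v))"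
  using assms
proof (induction u rule: list.induct)
  case Nil
  have [simp]: "map_option ((@) []) z = z" for z :: "'q list option"
    by (cases z) simp_all
  from Nil show ?case
    using qten_facts[of v i] by (cases "qten_eps \<alpha> Q i v") (auto simp: max_def)
next
  case (Cons x u)
  then have x: "x \<in> elems Q" and u: "u \<in> lists (elems Q)" and v: "v \<in> lists (elems Q)" by auto
  note pairing = pairing_add[OF wt_in[OF x] word_wt_in[OF u]] pairing_add[OF word_wt_in[OF u] word_wt_in[OF v]]
  have [simp]: "map_option ((@) (x # u)) z = map_option (\<lambda>w. x # u @ w) z" for z :: "'q list option"
    by (cases z) simp_all
  show ?case
    using letter_facts[OF x, of i] qten_facts[OF u, of i] qten_facts[OF v, of i]
    by (cases "eps Q i x"; cases "qten_eps \<alpha> Q i u"; cases "qten_eps \<alpha> Q i v")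
       (simp_all add: qten_Cons[OF x] Cons.IH[OF u v] qten_append_eps[OF u v, of i] pairing max_def option.map_comp comp_def)
qed

end

end

theory Submission
  imports Defs
begin

text \<open>An isomorphism between the components of \<open>u\<close> and \<open>v\<close> carrying \<open>u\<close> to \<open>v\<close> amounts to a
  one-to-one bisimulation relating \<open>u\<close> and \<open>v\<close>; bisimulations can be composed, inverted and
  concatenated, so both relations are congruences.

  If the letter weights are linearly independent, then \<open>\<alpha> i\<close> is a difference of two of them in at
  most one way.  Hence all letters on which \<open>eop i\<close> is defined share one weight, and their number in
  a word \<open>w\<close> is determined by the weight of \<open>w\<close>.  The value of \<open>eps i\<close> at \<open>w\<close> in the
  quasi-tensor structure is finite exactly when its value in the tensor structure is finite and
  equal to this number, and then the operators of both structures agree at \<open>w\<close>.  So a bisimulation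
  for the tensor structure is one for the quasi-tensor structure.\<close>

section \<open>Bisimulations\<close>

definition adjacent :: "('q, 'i, 'v) qcrystal \<Rightarrow> ('q \<times> 'q) set"
  where "adjacent W = {(a, b). \<exists>i. (a, i, b) \<in> qc_graph W \<or> (b, i, a) \<in> qc_graph W}"

text \<open>The graph of an isomorphism between components, without mention of components.
  \<open>bi_unique\<close> stands for single-valuedness and injectivity; \<open>rel_option\<close>
  demands that an operator be undefined on both sides at once, which the clauses for homomorphisms
  do not say.\<close>

definition bisimulation :: "('q, 'i, 'v) qcrystal \<Rightarrow> ('q \<Rightarrow> 'q \<Rightarrow> bool) \<Rightarrow> bool"
  where "bisimulation W R \<longleftrightarrow> bi_unique R \<and>
    (\<forall>x y. R x y \<longrightarrow> x \<in> elems W \<and> y \<in> elems W \<and> wt W x = wt W y \<and>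
       (\<forall>i. eps W i x = eps W i y \<and> phi W i x = phi W i y \<and>
            rel_option R (eop W i x) (eop W i y) \<and> rel_option R (fop W i x) (fop W i y)))"

lemma bisimulationD:
  assumes "bisimulation W R" "R x y"
  shows "x \<in> elems W" "y \<in> elems W" "wt W x = wt W y"
    "eps W i x = eps W i y" "phi W i x = phi W i y"
    "rel_option R (eop W i x) (eop W i y)" "rel_option R (fop W i x) (fop W i y)"
  using assms unfolding bisimulation_def by blast+

lemma bisimulation_eq:
  assumes "\<And>x i y. x \<in> elems W \<Longrightarrow> eop W i x = Some y \<Longrightarrow> y \<in> elems W"
    and "\<And>x i y. x \<in> elems W \<Longrightarrow> fop W i x = Some y \<Longrightarrow> y \<in> elems W"
  shows "bisimulation W (\<lambda>x y. x \<in> elems W \<and> x = y)"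
  unfolding bisimulation_def
proof (intro conjI allI impI, goal_cases)
  case 1 show ?case by (simp add: bi_unique_def)
next
  case (7 x y i)
  then have "eop W i x = Some z \<Longrightarrow> z \<in> elems W" for z using assms(1) by blast
  with 7 show ?case by (cases "eop W i x") simp_all
next
  case (8 x y i)
  then have "fop W i x = Some z \<Longrightarrow> z \<in> elems W" for z using assms(2) by blast
  with 8 show ?case by (cases "fop W i x") simp_all
qed auto

lemma bisimulation_conversep:
  assumes "bisimulation W R" shows "bisimulation W R\<inverse>\<inverse>"
  using assms unfolding bisimulation_def by (simp add: option.rel_conversep)

lemma bisimulation_OO:
  assumes "bisimulation W R" "bisimulation W S"
  shows "bisimulation W (R OO S)"
proof -
  have "bi_unique (R OO S)"
    using assms by (auto simp: bisimulation_def intro: bi_unique_OO)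
  moreover have "rel_option (R OO S) a c" if "rel_option R a b" "rel_option S b c" for a b c
    using that by (auto simp: option.rel_compp)
  ultimately show ?thesis
    using bisimulationD[OF assms(1)] bisimulationD[OF assms(2)]
    unfolding bisimulation_def relcompp_apply by (smt (verit, best))
qed

text \<open>The last two assumptions are the trace of seminormality used below: definedness of the
  operators can be read off from \<open>eps\<close> and \<open>phi\<close>, so a map preserving
  these values also reflects definedness.\<close>

locale regular_qcrystal =
  fixes W :: "('q, 'i, 'v) qcrystal"
  assumes e_closed: "x \<in> elems W \<Longrightarrow> eop W i x = Some y \<Longrightarrow> y \<in> elems W"
    and f_closed: "x \<in> elems W \<Longrightarrow> fop W i x = Some y \<Longrightarrow> y \<in> elems W"
    and e_iff_f: "x \<in> elems W \<Longrightarrow> y \<in> elems W \<Longrightarrow> eop W i x = Some y \<longleftrightarrow> fop W i y = Some x"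
    and e_None_iff: "x \<in> elems W \<Longrightarrow> eop W i x = None \<longleftrightarrow> eps W i x = Fin 0 \<or> eps W i x = Pinf"
    and f_None_iff: "x \<in> elems W \<Longrightarrow> fop W i x = None \<longleftrightarrow> phi W i x = Fin 0 \<or> phi W i x = Pinf"
begin

section \<open>Components and their isomorphisms\<close>

lemma component_set_eq: "component_set W x = {y \<in> elems W. (x, y) \<in> (adjacent W)\<^sup>*}"
  by (simp add: component_set_def adjacent_def)

lemma adjacent_e: "x \<in> elems W \<Longrightarrow> eop W i x = Some y \<Longrightarrow> (x, y) \<in> adjacent W"
  using e_closed[of x i y] e_iff_f[of x y i] by (auto simp: adjacent_def qc_graph_def)

lemma adjacent_f: "x \<in> elems W \<Longrightarrow> fop W i x = Some y \<Longrightarrow> (x, y) \<in> adjacent W"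
  using f_closed[of x i y] by (auto simp: adjacent_def qc_graph_def)

text \<open>A loop gives only \<open>y = x\<close>, and an edge of \<open>fop\<close> traversed
  backwards is a step of \<open>eop\<close>.\<close>

lemma adjacent_cases:
  assumes "(x, y) \<in> adjacent W"
  obtains "y = x" | i where "x \<in> elems W" "eop W i x = Some y"
    | i where "x \<in> elems W" "fop W i x = Some y"
  using assms e_iff_f[of x y] unfolding adjacent_def qc_graph_def by blast

lemma component_step:
  assumes "x \<in> component_set W u" "eop W i x = Some y \<or> fop W i x = Some y"
  shows "y \<in> component_set W u"
  using assms adjacent_e[of x i y] adjacent_f[of x i y] e_closed[of x i y] f_closed[of x i y]
  by (auto simp: component_set_eq intro: rtrancl_into_rtrancl)

text \<open>A path from \<open>u\<close> to \<open>x\<close> is copied step by step on the side of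
  \<open>v\<close>: \<open>rel_option\<close> provides the matching edge, and loops move neither
  end.\<close>

lemma bisimulation_component:
  assumes R: "bisimulation W R" "R u v" and x: "x \<in> component_set W u"
  shows "\<exists>y \<in> component_set W v. R x y"
proof -
  have "(u, x) \<in> (adjacent W)\<^sup>*" using x by (simp add: component_set_eq)
  then have "\<exists>y. (v, y) \<in> (adjacent W)\<^sup>* \<and> R x y"
  proof induction
    case base then show ?case using R by auto
  next
    case (step a b)
    then obtain a' where a': "(v, a') \<in> (adjacent W)\<^sup>*" "R a a'" by blast
    note D = bisimulationD[OF R(1) a'(2)]
    from step.hyps(2) show ?case
    proof (cases rule: adjacent_cases)
      case 1 with a' show ?thesis by blast
    next
      case (2 i)
      then obtain b' where "eop W i a' = Some b'" "R b b'"
        using D(6)[of i] by (auto simp: option_rel_Some1)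
      then show ?thesis using adjacent_e[OF D(2)] a'(1) by (meson rtrancl_into_rtrancl)
    next
      case (3 i)
      then obtain b' where "fop W i a' = Some b'" "R b b'"
        using D(7)[of i] by (auto simp: option_rel_Some1)
      then show ?thesis using adjacent_f[OF D(2)] a'(1) by (meson rtrancl_into_rtrancl)
    qed
  qed
  then show ?thesis using bisimulationD(2)[OF R(1)] by (auto simp: component_set_eq)
qed

lemma component_iso_if_bisimulation:
  assumes R: "bisimulation W R" "R u v"
  shows "(u, v) \<in> component_iso_rel W"
proof -
  \<comment> \<open>\<open>R\<close> is single-valued and, by \<open>bisimulation_component\<close>,
    total on the component of \<open>u\<close>; \<open>g\<close> is the function it induces
    there.\<close>
  define g where "g x = (THE y. R x y)" for x
  have uniq: "R x y \<Longrightarrow> R x z \<Longrightarrow> y = z" "R x z \<Longrightarrow> R y z \<Longrightarrow> x = y" for x y z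
    using R(1) unfolding bisimulation_def bi_unique_def by blast+
  have g: "g x = y" if "R x y" for x y
    unfolding g_def using that uniq(1) by blast
  have R_g: "R x (g x)" "g x \<in> component_set W v" if "x \<in> component_set W u" for x
    using bisimulation_component[OF R that] g by auto
  \<comment> \<open>Surjectivity is totality of the converse bisimulation on the component of
    \<open>v\<close>.\<close>
  have surj: "y \<in> g ` component_set W u" if "y \<in> component_set W v" for y
    using bisimulation_component[OF bisimulation_conversep[OF R(1)], of v u y] R(2) that g by force
  have "inj_on g (component_set W u)" using R_g(1) uniq(2) by (metis inj_onI)
  then have "bij_betw g (component_set W u) (component_set W v)"
    using surj R_g(2) by (auto simp: bij_betw_def)
  then have "bij_betw (map_option g) (pointed (component W u)) (pointed (component W v))"
    unfolding bij_betw_def by (simp add: pointed_def component_def image_image image_Un inj_on_def)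
      (metis image_image)
  moreover have "qc_hom (component W u) (component W v) (map_option g)"
    unfolding qc_hom_def
  proof (intro conjI ballI allI impI, goal_cases)
    case 1 show ?case using R_g(2) by (auto simp: pointed_def component_def)
  next
    case 2 show ?case by simp
  next
    case (3 x i y)
    with bisimulationD(3-5)[OF R(1) R_g(1)[of x]] show ?case by (simp add: component_def)
  next
    case (4 x i y)
    with bisimulationD(3-5)[OF R(1) R_g(1)[of x]] show ?case by (simp add: component_def)
  next
    case (5 x i y)
    with bisimulationD(3-5)[OF R(1) R_g(1)[of x]] show ?case by (simp add: component_def)
  next
    case (6 x i x' y y')
    then have "R x y" "R x' y'" "eop W i x = Some x'"
      using R_g(1)[of x] R_g(1)[of x'] component_step[of x u i x'] by (auto simp: component_def)
    \<comment> \<open>The bisimulation yields some partner of \<open>x'\<close>; uniqueness of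
      partners makes it \<open>y'\<close>.\<close>
    with bisimulationD(6)[OF R(1), of x y i] show ?case
      using uniq(1) by (auto simp: component_def option_rel_Some1)
  next
    case (7 x i x' y y')
    then have "R x y" "R x' y'" "fop W i x = Some x'"
      using R_g(1)[of x] R_g(1)[of x'] component_step[of x u i x'] by (auto simp: component_def)
    with bisimulationD(7)[OF R(1), of x y i] show ?case
      using uniq(1) by (auto simp: component_def option_rel_Some1)
  qed
  ultimately show ?thesis
    using g[OF R(2)] bisimulationD(1,2)[OF R] by (auto simp: component_iso_rel_def qc_iso_def)
qed

lemma bisimulation_if_component_iso:
  assumes "(u, v) \<in> component_iso_rel W"
  obtains R where "bisimulation W R" "R u v"
proof -
  from assms obtain \<psi> where u: "u \<in> elems W" and v: "v \<in> elems W"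
    and hom: "qc_hom (component W u) (component W v) \<psi>"
    and bij: "bij_betw \<psi> (pointed (component W u)) (pointed (component W v))"
    and uv: "\<psi> (Some u) = Some v"
    by (auto simp: component_iso_rel_def qc_iso_def)
  define R where "R x y \<longleftrightarrow> x \<in> component_set W u \<and> \<psi> (Some x) = Some y" for x y
  have [simp]: "pointed (component W w) = insert None (Some ` component_set W w)" for w
    by (simp add: pointed_def component_def)
  have inj: "inj_on \<psi> (insert None (Some ` component_set W u))" 
    using bij by (simp add: bij_betw_def)
  have None: "\<psi> None = None" using hom by (simp add: qc_hom_def)
  \<comment> \<open>By injectivity no element can share the image \<open>None\<close> of
    \<open>None\<close>.\<close>
  have ex: "\<exists>y. R x y" if "x \<in> component_set W u" for x
    using inj_onD[OF inj, of "Some x" None] None that by (cases "\<psi> (Some x)") (auto simp: R_def)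
  have in_v: "y \<in> component_set W v" if "R x y" for x y
  proof -
    have "Some y \<in> \<psi> ` insert None (Some ` component_set W u)"
      using that by (force simp: R_def)
    also have "\<dots> = insert None (Some ` component_set W v)" 
      using bij by (simp add: bij_betw_def)
    finally show ?thesis by auto
  qed
  have *: "wt W x = wt W y \<and> eps W i x = eps W i y \<and> phi W i x = phi W i y" if "R x y" for x y i
    using hom that unfolding qc_hom_def by (force simp: R_def component_def)
  have "rel_option R (eop W i x) (eop W i y)" if xy: "R x y" for x y i
  proof (cases "eop W i x")
    \<comment> \<open>The homomorphism clauses are silent where the operator is undefined;
      preservation of \<open>eps\<close> together with \<open>e_None_iff\<close> settles this
      case.\<close>
    case None
    moreover have "eop W i y = None"
      using None *[OF xy, of i] xy in_v[OF xy] by (auto simp: e_None_iff component_set_eq R_def)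
    ultimately show ?thesis by simp
  next
    case (Some x')
    then have "x' \<in> component_set W u" using component_step xy R_def by blast
    then obtain y' where y': "R x' y'" using ex by blast
    then have "eop W i y = Some y'"
      using hom xy Some unfolding qc_hom_def by (simp add: R_def component_def) blast
    with Some y' show ?thesis by simp
  qed
  moreover have "rel_option R (fop W i x) (fop W i y)" if xy: "R x y" for x y i
  proof (cases "fop W i x")
    case None
    moreover have "fop W i y = None"
      using None *[OF xy, of i] xy in_v[OF xy] by (auto simp: f_None_iff component_set_eq R_def)
    ultimately show ?thesis by simp
  next
    case (Some x')
    then have "x' \<in> component_set W u" using component_step xy R_def by blast
    then obtain y' where y': "R x' y'" using ex by blast
    then have "fop W i y = Some y'"
      using hom xy Some unfolding qc_hom_def by (simp add: R_def component_def) blast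
    with Some y' show ?thesis by simp
  qed
  moreover have "bi_unique R"
    using inj by (force simp: bi_unique_def R_def inj_on_def)
  moreover have "x \<in> elems W \<and> y \<in> elems W" if "R x y" for x y
    using that in_v[OF that] by (auto simp: R_def component_set_eq)
  ultimately have "bisimulation W R"
    using * unfolding bisimulation_def by blast
  moreover have "R u v" using u uv by (simp add: R_def component_set_eq)
  ultimately show ?thesis by (rule that)
qed

lemma equiv_component_iso_rel: "equiv (elems W) (component_iso_rel W)"
proof (intro equivI)
  show "component_iso_rel W \<subseteq> elems W \<times> elems W" by (auto simp: component_iso_rel_def)
  show "refl_on (elems W) (component_iso_rel W)"
  proof (rule refl_onI)
    fix u assume "u \<in> elems W"
    then show "(u, u) \<in> component_iso_rel W"
      by (intro component_iso_if_bisimulation[OF bisimulation_eq[OF e_closed f_closed]]) simp_all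
  qed
  show "sym (component_iso_rel W)"
  proof (rule symI)
    fix u v assume "(u, v) \<in> component_iso_rel W"
    then obtain R where "bisimulation W R" "R u v"
      by (rule bisimulation_if_component_iso)
    then show "(v, u) \<in> component_iso_rel W"
      by (intro component_iso_if_bisimulation[of "R\<inverse>\<inverse>"] bisimulation_conversep conversepI)
  qed
  show "trans (component_iso_rel W)"
  proof (rule transI)
    fix u v w assume "(u, v) \<in> component_iso_rel W" "(v, w) \<in> component_iso_rel W"
    then obtain R S where "bisimulation W R" "R u v" "bisimulation W S" "S v w"
      by (elim bisimulation_if_component_iso)
    then show "(u, w) \<in> component_iso_rel W"
      by (intro component_iso_if_bisimulation[of "R OO S"] bisimulation_OO relcomppI)
  qed
qed

end

section \<open>Signature rules\<close>

lemma iter_op_0: "iter_op g 0 x = Some x"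
  by (simp add: iter_op_def)

text \<open>The definition exposes the last application of \<open>g\<close>; exposing the first one
  lets iterates from \<open>x\<close> be compared with iterates from the value of \<open>g\<close>
  at \<open>x\<close>.\<close>

lemma iter_op_Suc: "iter_op g (Suc k) x = Option.bind (g x) (iter_op g k)"
proof -
  have "((\<lambda>z. Option.bind z g) ^^ k) None = None" by (induction k) auto
  then show ?thesis
    by (cases "g x") (simp_all add: iter_op_def funpow_Suc_right del: funpow.simps)
qed

text \<open>The possible iteration counts at \<open>x\<close> are 0 and the successors of those at
  \<open>y\<close>. The latter set contains 0, so \<open>Max\<close> commutes with
  \<open>Suc\<close> on it.\<close>

lemma Max_iter_op_Some:
  assumes "g x = Some y" "finite {k. iter_op g k x \<noteq> None}" "finite {k. iter_op g k y \<noteq> None}"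
  shows "Max {k. iter_op g k x \<noteq> None} = Suc (Max {k. iter_op g k y \<noteq> None})"
proof -
  let ?Y = "{k. iter_op g k y \<noteq> None}"
  have "{k. iter_op g k x \<noteq> None} = insert 0 (Suc ` ?Y)"
  proof (rule Set.set_eqI)
    fix k show "k \<in> {k. iter_op g k x \<noteq> None} \<longleftrightarrow> k \<in> insert 0 (Suc ` ?Y)"
      using assms(1) by (cases k) (auto simp: iter_op_0 iter_op_Suc)
  qed
  moreover have "?Y \<noteq> {}" by (auto simp: iter_op_0 intro: exI[of _ 0])
  ultimately show ?thesis
    using assms(3) by (simp add: mono_Max_commute[of Suc, symmetric] mono_Suc)
qed

lemma Max_iter_op_None:
  assumes "g x = None"
  shows "Max {k. iter_op g k x \<noteq> None} = 0"
proof -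
  have "iter_op g k x \<noteq> None \<longleftrightarrow> k = 0" for k
    using assms by (cases k) (auto simp: iter_op_0 iter_op_Suc)
  then show ?thesis by simp
qed

context seminormal_quasi_crystal
begin

section \<open>Steps along strings of letters\<close>

lemma simple_root_weight: "\<alpha> i \<in> \<Lambda>"
  using simple_root roots_weights by blast

lemma pairing_simple_root [simp]: "pairing (\<alpha> i) (\<alpha> i) = 2"
  using simple_root[of i] zero_not_root by (cases "\<alpha> i = 0") (auto simp: pairing_def coroot_def)

text \<open>\<open>eps\<close> counts the steps of \<open>eop\<close> still possible, so it drops by
  one; the pairing grows by 2, hence \<open>phi\<close> grows by one. Infinite values are excluded
  because \<open>eop\<close> acts at \<open>x\<close> and \<open>fop\<close> at
  \<open>y\<close>.\<close>

lemma letter_e_Some: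
  assumes x: "x \<in> elems Q" and e: "eop Q i x = Some y"
  shows "y \<in> elems Q" "wt Q y = wt Q x + \<alpha> i" "fop Q i y = Some x"
    "pairing (wt Q y) (\<alpha> i) = pairing (wt Q x) (\<alpha> i) + 2"
    "eps Q i x = eps Q i y + Fin 1" "phi Q i y = phi Q i x + Fin 1"
    "eps Q i x \<noteq> Pinf" "eps Q i y \<noteq> Pinf" "phi Q i x \<noteq> Pinf"
proof -
  show y: "y \<in> elems Q" using eop_closed[OF x e] .
  show wt: "wt Q y = wt Q x + \<alpha> i" using wt_eop[OF x e] .
  show f: "fop Q i y = Some x" using eop_fop[OF x y] e by simp
  show p: "pairing (wt Q y) (\<alpha> i) = pairing (wt Q x) (\<alpha> i) + 2"
    by (simp add: wt pairing_add[OF wt_in[OF x] simple_root_weight])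
  show fin: "eps Q i x \<noteq> Pinf" "eps Q i y \<noteq> Pinf"
    using eps_infinite[OF x] eps_infinite[OF y] e f by auto
  show eps: "eps Q i x = eps Q i y + Fin 1"
    using eps_finite[OF x fin(1)] eps_finite[OF y fin(2)] Max_iter_op_Some[of "eop Q i", OF e] by simp
  show "phi Q i y = phi Q i x + Fin 1"
    using phi_eps[OF x, of i] phi_eps[OF y, of i] eps p by (cases "eps Q i y") simp_all
  show "phi Q i x \<noteq> Pinf"
    using phi_eps[OF x, of i] fin(1) by (cases "eps Q i x") simp_all
qed

lemma letter_f_Some:
  assumes "x \<in> elems Q" "fop Q i x = Some y"
  shows "y \<in> elems Q" "eop Q i y = Some x"
  using fop_closed[OF assms] eop_fop[OF fop_closed[OF assms] assms(1)] assms(2) by auto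

lemma letter_None:
  assumes x: "x \<in> elems Q"
  shows "eop Q i x = None \<longleftrightarrow> eps Q i x = Fin 0 \<or> eps Q i x = Pinf"
    "fop Q i x = None \<longleftrightarrow> phi Q i x = Fin 0 \<or> phi Q i x = Pinf"
proof -
  have phi_Pinf: "phi Q i x = Pinf" if "eps Q i x = Pinf"
    using that phi_eps[OF x, of i] by simp
  show "eop Q i x = None \<longleftrightarrow> eps Q i x = Fin 0 \<or> eps Q i x = Pinf"
    using eps_finite[OF x, of i] Max_iter_op_None[of "eop Q i" x] letter_facts(4)[OF x, of i]
    by (metis of_nat_0)
  show "fop Q i x = None \<longleftrightarrow> phi Q i x = Fin 0 \<or> phi Q i x = Pinf"
    using phi_finite[OF x, of i] Max_iter_op_None[of "fop Q i" x] letter_facts(5)[OF x, of i] phi_Pinf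
    by (metis of_nat_0)
qed

text \<open>The weak comparison for \<open>e\<close> and the strict one for \<open>f\<close> fit
  together. If \<open>e\<close> acts on the first letter, its \<open>phi\<close> grows by one and
  exceeds \<open>eps\<close> of the rest; if it acts on the rest, \<open>eps\<close> there drops by
  one and is still at least \<open>phi\<close> of the letter. So \<open>f\<close> acts at the same
  position and undoes the step.\<close>

lemma ten_e_Some:
  assumes "w \<in> lists (elems Q)" "ten_e \<alpha> Q i w = Some w'"
  shows "w' \<in> lists (elems Q) \<and> length w' = length w \<and>
    ten_eps \<alpha> Q i w = ten_eps \<alpha> Q i w' + Fin 1 \<and> ten_f \<alpha> Q i w' = Some w"
  using assms
proof (induction w arbitrary: w' rule: list.induct)
  case (Cons x w)
  then have x: "x \<in> elems Q" and w: "w \<in> lists (elems Q)" by auto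
  note facts = letter_facts(1-3)[OF x, of i] ten_facts[OF w, of i]
  show ?case
  proof (cases "phi Q i x \<ge> ten_eps \<alpha> Q i w")
    case True
    with Cons.prems(2) obtain x' where x': "eop Q i x = Some x'" "w' = x' # w"
      by (auto simp: ten_Cons[OF x])
    note X = letter_e_Some[OF x x'(1)]
    \<comment> \<open>Naming the finite values as integers turns the comparison and the maxima into
      linear arithmetic.\<close>
    obtain n where n: "eps Q i x' = Fin n" "n \<ge> 0"
      using letter_facts(1)[OF X(1), of i] X(8) by (cases "eps Q i x'") auto
    then have phi: "eps Q i x = Fin (n + 1)" "phi Q i x = Fin (n + 1 + pairing (wt Q x) (\<alpha> i))"
      "phi Q i x' = Fin (n + 2 + pairing (wt Q x) (\<alpha> i))"
      using X(5,6) facts(3) by auto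
    with True facts obtain m where m: "ten_eps \<alpha> Q i w = Fin m" "m \<ge> 0"
      by (cases "ten_eps \<alpha> Q i w") auto
    show ?thesis
      using True w X(1-4) by (simp add: x'(2) ten_Cons[OF x] ten_Cons[OF X(1)] phi n m max_def)
  next
    case False
    with Cons.prems(2) obtain v where v: "ten_e \<alpha> Q i w = Some v" "w' = x # v"
      by (auto simp: ten_Cons[OF x])
    note V = Cons.IH[OF w v(1)]
    obtain k where k: "ten_eps \<alpha> Q i v = Fin k" "ten_eps \<alpha> Q i w = Fin (k + 1)" "k \<ge> 0"
      using facts(4) V v(1) ten_facts[of v i] by (cases "ten_eps \<alpha> Q i v") auto
    obtain n where n: "eps Q i x = Fin n" "phi Q i x = Fin (n + pairing (wt Q x) (\<alpha> i))"
        "n \<ge> 0" "n + pairing (wt Q x) (\<alpha> i) \<ge> 0"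
      using facts False k by (cases "eps Q i x") auto
    show ?thesis
      using False V x Cons.prems(2) n(3,4) k(3)
      by (auto simp: v(2) ten_Cons[OF x] n(1,2) k(1,2) max_def split: if_splits)
  qed
qed simp

text \<open>Dual to \<open>ten_e_Some\<close>: either \<open>phi\<close> of the first letter drops
  by one and stays at least \<open>eps\<close> of the rest, or \<open>eps\<close> of the rest grows
  by one and exceeds it.\<close>

lemma ten_f_Some:
  assumes "w \<in> lists (elems Q)" "ten_f \<alpha> Q i w = Some w'"
  shows "w' \<in> lists (elems Q) \<and> length w' = length w \<and>
    ten_eps \<alpha> Q i w' = ten_eps \<alpha> Q i w + Fin 1 \<and> ten_e \<alpha> Q i w' = Some w"
  using assms
proof (induction w arbitrary: w' rule: list.induct)
  case (Cons x w)
  then have x: "x \<in> elems Q" and w: "w \<in> lists (elems Q)" by auto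
  note facts = letter_facts(1-3)[OF x, of i] ten_facts[OF w, of i]
  show ?case
  proof (cases "phi Q i x > ten_eps \<alpha> Q i w")
    case True
    with Cons.prems(2) obtain x' where x': "fop Q i x = Some x'" "w' = x' # w"
      by (auto simp: ten_Cons[OF x])
    note x'' = letter_f_Some[OF x x'(1)]
    note X = letter_e_Some[OF x'']
    obtain n where n: "eps Q i x = Fin n" "n \<ge> 0"
      using letter_facts(1)[OF x, of i] X(8) by (cases "eps Q i x") auto
    then have phi: "eps Q i x' = Fin (n + 1)" "phi Q i x' = Fin (n - 1 + pairing (wt Q x) (\<alpha> i))"
      "phi Q i x = Fin (n + pairing (wt Q x) (\<alpha> i))"
      using X(4,5) facts(3) letter_facts(3)[OF x''(1), of i] by auto
    with True facts obtain m where m: "ten_eps \<alpha> Q i w = Fin m" "m \<ge> 0"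
      by (cases "ten_eps \<alpha> Q i w") auto
    show ?thesis
      using True w x'' X(4) by (simp add: x'(2) ten_Cons[OF x] ten_Cons[OF x''(1)] phi n m max_def)
  next
    case False
    with Cons.prems(2) obtain v where v: "ten_f \<alpha> Q i w = Some v" "w' = x # v"
      by (auto simp: ten_Cons[OF x])
    note V = Cons.IH[OF w v(1)]
    obtain k where k: "ten_eps \<alpha> Q i w = Fin k" "ten_eps \<alpha> Q i v = Fin (k + 1)" "k \<ge> 0"
      using facts(4) V v(1) ten_facts[of v i] by (cases "ten_eps \<alpha> Q i w") auto
    obtain n where n: "eps Q i x = Fin n" "phi Q i x = Fin (n + pairing (wt Q x) (\<alpha> i))"
        "n \<ge> 0" "n + pairing (wt Q x) (\<alpha> i) \<ge> 0"
      using facts False k by (cases "eps Q i x") auto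
    show ?thesis
      using False V x Cons.prems(2) n(3,4) k(3)
      by (auto simp: v(2) ten_Cons[OF x] n(1,2) k(1,2) max_def split: if_splits)
  qed
qed simp

text \<open>Adds the converse of the last two claims of \<open>ten_facts\<close>: the comparison
  selects the factor at which the maximum is attained, so a positive finite value makes the operator
  defined on that factor.\<close>

lemma ten_None:
  assumes "w \<in> lists (elems Q)"
  shows "(ten_e \<alpha> Q i w = None \<longleftrightarrow> ten_eps \<alpha> Q i w = Fin 0 \<or> ten_eps \<alpha> Q i w = Pinf) \<and>
    (ten_f \<alpha> Q i w = None \<longleftrightarrow> ten_phi \<alpha> Q i w = Fin 0 \<or> ten_phi \<alpha> Q i w = Pinf)"
  using assms
proof (induction w rule: list.induct)
  case (Cons x w)
  then have x: "x \<in> elems Q" and w: "w \<in> lists (elems Q)" by auto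
  show ?case
    using letter_facts(1-3)[OF x, of i] ten_facts[OF w, of i] letter_None[OF x, of i] Cons.IH[OF w]
    by (cases "eps Q i x"; cases "ten_eps \<alpha> Q i w") (auto simp add: ten_Cons[OF x] max_def)
qed simp

lemma regular_tensor_words: "regular_qcrystal (tensor_words \<alpha> Q)"
proof
  fix w v i
  assume w: "w \<in> elems (tensor_words \<alpha> Q)"
  show "v \<in> elems (tensor_words \<alpha> Q)" if "eop (tensor_words \<alpha> Q) i w = Some v"
    using that w ten_e_Some[of w i v] by (simp add: tensor_words_def)
  show "v \<in> elems (tensor_words \<alpha> Q)" if "fop (tensor_words \<alpha> Q) i w = Some v"
    using that w ten_f_Some[of w i v] by (simp add: tensor_words_def)
  show "eop (tensor_words \<alpha> Q) i w = None \<longleftrightarrow>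
      eps (tensor_words \<alpha> Q) i w = Fin 0 \<or> eps (tensor_words \<alpha> Q) i w = Pinf"
    using w ten_None[of w i] by (simp add: tensor_words_def)
  show "fop (tensor_words \<alpha> Q) i w = None \<longleftrightarrow>
      phi (tensor_words \<alpha> Q) i w = Fin 0 \<or> phi (tensor_words \<alpha> Q) i w = Pinf"
    using w ten_None[of w i] by (simp add: tensor_words_def)
  assume "v \<in> elems (tensor_words \<alpha> Q)"
  then show "eop (tensor_words \<alpha> Q) i w = Some v \<longleftrightarrow> fop (tensor_words \<alpha> Q) i v = Some w"
    using w ten_e_Some[of w i v] ten_f_Some[of v i w] by (auto simp: tensor_words_def)
qed

text \<open>As for \<open>ten_e_Some\<close>, with one more point, which also holds for
  \<open>qten_f_Some\<close>. An operator can act on the first letter only if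
  \<open>qten_eps\<close> of the rest is 0, and on the rest only if \<open>phi\<close> of the letter
  is 0. The step leaves this 0 unchanged, so the infinite clause does not apply afterwards
  either.\<close>

lemma qten_e_Some:
  assumes "w \<in> lists (elems Q)" "qten_e \<alpha> Q i w = Some w'"
  shows "w' \<in> lists (elems Q) \<and> length w' = length w \<and>
    qten_eps \<alpha> Q i w = qten_eps \<alpha> Q i w' + Fin 1 \<and> qten_f \<alpha> Q i w' = Some w"
  using assms
proof (induction w arbitrary: w' rule: list.induct)
  case (Cons x w)
  then have x: "x \<in> elems Q" and w: "w \<in> lists (elems Q)" by auto
  note facts = letter_facts(1-3)[OF x, of i] qten_facts[OF w, of i]
  show ?case
  proof (cases "\<not> (phi Q i x > Fin 0 \<and> qten_eps \<alpha> Q i w > Fin 0) \<and> phi Q i x \<ge> qten_eps \<alpha> Q i w")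
    case True
    with Cons.prems(2) obtain x' where x': "eop Q i x = Some x'" "w' = x' # w"
      by (auto simp: qten_Cons[OF x])
    note X = letter_e_Some[OF x x'(1)]
    obtain n where n: "eps Q i x' = Fin n" "n \<ge> 0"
      using letter_facts(1)[OF X(1), of i] X(8) by (cases "eps Q i x'") auto
    then have phi: "eps Q i x = Fin (n + 1)" "phi Q i x = Fin (n + 1 + pairing (wt Q x) (\<alpha> i))"
      "phi Q i x' = Fin (n + 2 + pairing (wt Q x) (\<alpha> i))"
      using X(5,6) facts(3) by auto
    with True facts obtain m where m: "qten_eps \<alpha> Q i w = Fin m" "m \<ge> 0"
      by (cases "qten_eps \<alpha> Q i w") auto
    show ?thesis
      using True w X(1-4) m(2) by (auto simp add: x'(2) qten_Cons[OF x] qten_Cons[OF X(1)] phi n m(1) max_def)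
  next
    \<comment> \<open>The negated condition also admits the infinite clause, which is excluded
      because the operator is defined.\<close>
    case False
    with Cons.prems(2) obtain v where v: "qten_e \<alpha> Q i w = Some v" "w' = x # v"
      by (auto simp: qten_Cons[OF x] split: if_splits)
    note V = Cons.IH[OF w v(1)]
    obtain k where k: "qten_eps \<alpha> Q i v = Fin k" "qten_eps \<alpha> Q i w = Fin (k + 1)" "k \<ge> 0"
      using facts(4) V v(1) qten_facts[of v i] by (cases "qten_eps \<alpha> Q i v") auto
    obtain n where n: "eps Q i x = Fin n" "phi Q i x = Fin (n + pairing (wt Q x) (\<alpha> i))"
        "n \<ge> 0" "n + pairing (wt Q x) (\<alpha> i) \<ge> 0"
      using facts(1-3) False k Cons.prems(2)
      by (cases "eps Q i x") (auto simp: qten_Cons[OF x] split: if_splits)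
    show ?thesis
      using False V x Cons.prems(2) n(3,4) k(3)
      by (auto simp: v(2) qten_Cons[OF x] n(1,2) k(1,2) max_def split: if_splits)
  qed
qed simp

lemma qten_f_Some:
  assumes "w \<in> lists (elems Q)" "qten_f \<alpha> Q i w = Some w'"
  shows "w' \<in> lists (elems Q) \<and> length w' = length w \<and>
    qten_eps \<alpha> Q i w' = qten_eps \<alpha> Q i w + Fin 1 \<and> qten_e \<alpha> Q i w' = Some w"
  using assms
proof (induction w arbitrary: w' rule: list.induct)
  case (Cons x w)
  then have x: "x \<in> elems Q" and w: "w \<in> lists (elems Q)" by auto
  note facts = letter_facts(1-3)[OF x, of i] qten_facts[OF w, of i]
  show ?case
  proof (cases "\<not> (phi Q i x > Fin 0 \<and> qten_eps \<alpha> Q i w > Fin 0) \<and> phi Q i x > qten_eps \<alpha> Q i w")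
    case True
    with Cons.prems(2) obtain x' where x': "fop Q i x = Some x'" "w' = x' # w"
      by (auto simp: qten_Cons[OF x])
    note x'' = letter_f_Some[OF x x'(1)]
    note X = letter_e_Some[OF x'']
    obtain n where n: "eps Q i x = Fin n" "n \<ge> 0"
      using letter_facts(1)[OF x, of i] X(8) by (cases "eps Q i x") auto
    then have phi: "eps Q i x' = Fin (n + 1)" "phi Q i x' = Fin (n - 1 + pairing (wt Q x) (\<alpha> i))"
      "phi Q i x = Fin (n + pairing (wt Q x) (\<alpha> i))"
      using X(4,5) facts(3) letter_facts(3)[OF x''(1), of i] by auto
    with True facts obtain m where m: "qten_eps \<alpha> Q i w = Fin m" "m \<ge> 0"
      by (cases "qten_eps \<alpha> Q i w") auto
    show ?thesis
      using True w x'' X(4) m(2) by (auto simp add: x'(2) qten_Cons[OF x] qten_Cons[OF x''(1)] phi n m(1) max_def)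
  next
    case False
    with Cons.prems(2) obtain v where v: "qten_f \<alpha> Q i w = Some v" "w' = x # v"
      by (auto simp: qten_Cons[OF x] split: if_splits)
    note V = Cons.IH[OF w v(1)]
    obtain k where k: "qten_eps \<alpha> Q i w = Fin k" "qten_eps \<alpha> Q i v = Fin (k + 1)" "k \<ge> 0"
      using facts(4) V v(1) qten_facts[of v i] by (cases "qten_eps \<alpha> Q i w") auto
    obtain n where n: "eps Q i x = Fin n" "phi Q i x = Fin (n + pairing (wt Q x) (\<alpha> i))"
        "n \<ge> 0" "n + pairing (wt Q x) (\<alpha> i) \<ge> 0"
      using facts(1-3) False k Cons.prems(2)
      by (cases "eps Q i x") (auto simp: qten_Cons[OF x] split: if_splits)
    show ?thesis
      using False V x Cons.prems(2) n(3,4) k(3)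
      by (auto simp: v(2) qten_Cons[OF x] n(1,2) k(1,2) max_def split: if_splits)
  qed
qed simp

lemma qten_None:
  assumes "w \<in> lists (elems Q)"
  shows "(qten_e \<alpha> Q i w = None \<longleftrightarrow> qten_eps \<alpha> Q i w = Fin 0 \<or> qten_eps \<alpha> Q i w = Pinf) \<and>
    (qten_f \<alpha> Q i w = None \<longleftrightarrow> qten_phi \<alpha> Q i w = Fin 0 \<or> qten_phi \<alpha> Q i w = Pinf)"
  using assms
proof (induction w rule: list.induct)
  case (Cons x w)
  then have x: "x \<in> elems Q" and w: "w \<in> lists (elems Q)" by auto
  show ?case
    using letter_facts(1-3)[OF x, of i] qten_facts[OF w, of i] letter_None[OF x, of i] Cons.IH[OF w]
    by (cases "eps Q i x"; cases "qten_eps \<alpha> Q i w") (auto simp add: qten_Cons[OF x] max_def)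
qed simp

lemma regular_qtensor_words: "regular_qcrystal (qtensor_words \<alpha> Q)"
proof
  fix w v i
  assume w: "w \<in> elems (qtensor_words \<alpha> Q)"
  show "v \<in> elems (qtensor_words \<alpha> Q)" if "eop (qtensor_words \<alpha> Q) i w = Some v"
    using that w qten_e_Some[of w i v] by (simp add: qtensor_words_def)
  show "v \<in> elems (qtensor_words \<alpha> Q)" if "fop (qtensor_words \<alpha> Q) i w = Some v"
    using that w qten_f_Some[of w i v] by (simp add: qtensor_words_def)
  show "eop (qtensor_words \<alpha> Q) i w = None \<longleftrightarrow>
      eps (qtensor_words \<alpha> Q) i w = Fin 0 \<or> eps (qtensor_words \<alpha> Q) i w = Pinf"
    using w qten_None[of w i] by (simp add: qtensor_words_def)
  show "fop (qtensor_words \<alpha> Q) i w = None \<longleftrightarrow>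
      phi (qtensor_words \<alpha> Q) i w = Fin 0 \<or> phi (qtensor_words \<alpha> Q) i w = Pinf"
    using w qten_None[of w i] by (simp add: qtensor_words_def)
  assume "v \<in> elems (qtensor_words \<alpha> Q)"
  then show "eop (qtensor_words \<alpha> Q) i w = Some v \<longleftrightarrow> fop (qtensor_words \<alpha> Q) i v = Some w"
    using w qten_e_Some[of w i v] qten_f_Some[of v i w] by (auto simp: qtensor_words_def)
qed

end

section \<open>Concatenation\<close>

text \<open>The data on which the branching for concatenations depends; the operators themselves are
  left out.\<close>

definition same_signature :: "('q, 'i, 'v) qcrystal \<Rightarrow> 'q \<Rightarrow> 'q \<Rightarrow> bool"
  where "same_signature W u v \<longleftrightarrow> u \<in> elems W \<and> v \<in> elems W \<and> wt W u = wt W v \<and>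
    (\<forall>i. eps W i u = eps W i v \<and> phi W i u = phi W i v)"

text \<open>What the congruence proof uses of either structure: words with equal data take the same
  branch, namely both undefined, both acting on the left factor, or both on the right.\<close>

locale word_qcrystal = regular_qcrystal W for W :: "('q list, 'i, 'v) qcrystal" +
  assumes e_length: "u \<in> elems W \<Longrightarrow> eop W i u = Some v \<Longrightarrow> length v = length u"
    and f_length: "u \<in> elems W \<Longrightarrow> fop W i u = Some v \<Longrightarrow> length v = length u"
    and append_signature: "same_signature W u u' \<Longrightarrow> same_signature W v v' \<Longrightarrow>
          same_signature W (u @ v) (u' @ v')"
    and append_e: "same_signature W u u' \<Longrightarrow> same_signature W v v' \<Longrightarrow>
          eop W i (u @ v) = None \<and> eop W i (u' @ v') = None \<or>
          eop W i (u @ v) = map_option (\<lambda>z. z @ v) (eop W i u) \<and>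
          eop W i (u' @ v') = map_option (\<lambda>z. z @ v') (eop W i u') \<or>
          eop W i (u @ v) = map_option (\<lambda>z. u @ z) (eop W i v) \<and>
          eop W i (u' @ v') = map_option (\<lambda>z. u' @ z) (eop W i v')"
    and append_f: "same_signature W u u' \<Longrightarrow> same_signature W v v' \<Longrightarrow>
          fop W i (u @ v) = None \<and> fop W i (u' @ v') = None \<or>
          fop W i (u @ v) = map_option (\<lambda>z. z @ v) (fop W i u) \<and>
          fop W i (u' @ v') = map_option (\<lambda>z. z @ v') (fop W i u') \<or>
          fop W i (u @ v) = map_option (\<lambda>z. u @ z) (fop W i v) \<and>
          fop W i (u' @ v') = map_option (\<lambda>z. u' @ z) (fop W i v')"
begin

lemma component_iso_rel_append:
  assumes "(a, a') \<in> component_iso_rel W" "(b, b') \<in> component_iso_rel W"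
  shows "(a @ b, a' @ b') \<in> component_iso_rel W"
proof -
  from assms obtain R S where R: "bisimulation W R" "R a a'" and S: "bisimulation W S" "S b b'"
    by (elim bisimulation_if_component_iso)
  \<comment> \<open>Fixing the lengths of the left factors makes the splittings of \<open>z\<close>
    and \<open>z'\<close> unique, so that \<open>T\<close> inherits \<open>bi_unique\<close> from
    \<open>R\<close> and \<open>S\<close>.\<close>
  define T where "T z z' \<longleftrightarrow> (\<exists>x y x' y'. z = x @ y \<and> z' = x' @ y' \<and> R x x' \<and> S y y' \<and>
    length x = length a \<and> length x' = length a')" for z z'
  have T: "T (x @ y) (x' @ y')"
    if "R x x'" "S y y'" "length x = length a" "length x' = length a'" for x y x' y'
    using that unfolding T_def by blast
  have sig: "same_signature W x y" if "bisimulation W B" "B x y" for B x y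
    using bisimulationD[OF that] by (simp add: same_signature_def)
  have "R x y \<Longrightarrow> R x z \<Longrightarrow> y = z" "R x z \<Longrightarrow> R y z \<Longrightarrow> x = y"
    "S x y \<Longrightarrow> S x z \<Longrightarrow> y = z" "S x z \<Longrightarrow> S y z \<Longrightarrow> x = y" for x y z
    using R S unfolding bisimulation_def bi_unique_def by blast+
  then have "bi_unique T" unfolding bi_unique_def T_def by (simp, safe; simp)
  moreover have "same_signature W z z' \<and>
      rel_option T (eop W i z) (eop W i z') \<and> rel_option T (fop W i z) (fop W i z')"
    if "T z z'" for z z' i
  proof -
    from that obtain x y x' y' where z: "z = x @ y" "z' = x' @ y'"
      and xy: "R x x'" "S y y'" "length x = length a" "length x' = length a'"
      unfolding T_def by blast
    note DR = bisimulationD[OF R(1) xy(1)] and DS = bisimulationD[OF S(1) xy(2)]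
    note sig2 = sig[OF R(1) xy(1)] sig[OF S(1) xy(2)]
    have "rel_option T (eop W i (x @ y)) (eop W i (x' @ y'))"
      using append_e[OF sig2, of i]
    proof (elim disjE conjE, goal_cases)
      case 1 then show ?case by simp
    next
      case 2
      \<comment> \<open>Operators preserve length, so the new left factors still satisfy the length
        condition in \<open>T\<close>.\<close>
      have "rel_option (\<lambda>u v. T (u @ y) (v @ y')) (eop W i x) (eop W i x')"
        using DR(6)[of i] by (rule option.rel_mono_strong)
          (use T xy DR(1,2) e_length[of x i] e_length[of x' i] in auto)
      with 2 show ?case by (simp add: option.rel_map)
    next
      case 3
      have "rel_option (\<lambda>u v. T (x @ u) (x' @ v)) (eop W i y) (eop W i y')"
        using DS(6)[of i] by (rule option.rel_mono_strong) (use T xy in auto)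
      with 3 show ?case by (simp add: option.rel_map)
    qed
    moreover have "rel_option T (fop W i (x @ y)) (fop W i (x' @ y'))"
      using append_f[OF sig2, of i]
    proof (elim disjE conjE, goal_cases)
      case 1 then show ?case by simp
    next
      case 2
      have "rel_option (\<lambda>u v. T (u @ y) (v @ y')) (fop W i x) (fop W i x')"
        using DR(7)[of i] by (rule option.rel_mono_strong)
          (use T xy DR(1,2) f_length[of x i] f_length[of x' i] in auto)
      with 2 show ?case by (simp add: option.rel_map)
    next
      case 3
      have "rel_option (\<lambda>u v. T (x @ u) (x' @ v)) (fop W i y) (fop W i y')"
        using DS(7)[of i] by (rule option.rel_mono_strong) (use T xy in auto)
      with 3 show ?case by (simp add: option.rel_map)
    qed
    ultimately show ?thesis using append_signature[OF sig2] by (simp add: z)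
  qed
  ultimately have "bisimulation W T"
    unfolding bisimulation_def same_signature_def by blast
  moreover have "T (a @ b) (a' @ b')" using R(2) S(2) by (intro T) auto
  ultimately show ?thesis by (rule component_iso_if_bisimulation)
qed

end

context seminormal_quasi_crystal
begin

lemma word_qcrystal_tensor_words: "word_qcrystal (tensor_words \<alpha> Q)"
proof -
  interpret regular_qcrystal "tensor_words \<alpha> Q" by (rule regular_tensor_words)
  show ?thesis
  proof
    fix u u' v v' i
    show "length v = length u"
      if "u \<in> elems (tensor_words \<alpha> Q)" "eop (tensor_words \<alpha> Q) i u = Some v"
      using that ten_e_Some[of u i v] by (simp add: tensor_words_def)
    show "length v = length u"
      if "u \<in> elems (tensor_words \<alpha> Q)" "fop (tensor_words \<alpha> Q) i u = Some v"
      using that ten_f_Some[of u i v] by (simp add: tensor_words_def)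
    assume "same_signature (tensor_words \<alpha> Q) u u'" "same_signature (tensor_words \<alpha> Q) v v'"
    note sig = this[unfolded same_signature_def tensor_words_def, simplified]
    have *: "\<forall>x\<in>set u. x \<in> elems Q" "\<forall>x\<in>set v. x \<in> elems Q"
      "\<forall>x\<in>set u'. x \<in> elems Q" "\<forall>x\<in>set v'. x \<in> elems Q"
      using sig by auto
    show "same_signature (tensor_words \<alpha> Q) (u @ v) (u' @ v')"
      using sig * by (auto simp: same_signature_def tensor_words_def ten_append_eps ten_append_phi in_lists_conv_set)
    show "eop (tensor_words \<alpha> Q) i (u @ v) = None \<and> eop (tensor_words \<alpha> Q) i (u' @ v') = None \<or>
        eop (tensor_words \<alpha> Q) i (u @ v) = map_option (\<lambda>z. z @ v) (eop (tensor_words \<alpha> Q) i u) \<and>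
        eop (tensor_words \<alpha> Q) i (u' @ v') = map_option (\<lambda>z. z @ v') (eop (tensor_words \<alpha> Q) i u') \<or>
        eop (tensor_words \<alpha> Q) i (u @ v) = map_option (\<lambda>z. u @ z) (eop (tensor_words \<alpha> Q) i v) \<and>
        eop (tensor_words \<alpha> Q) i (u' @ v') = map_option (\<lambda>z. u' @ z) (eop (tensor_words \<alpha> Q) i v')"
      using sig * by (simp add: tensor_words_def ten_append_e in_lists_conv_set)
    show "fop (tensor_words \<alpha> Q) i (u @ v) = None \<and> fop (tensor_words \<alpha> Q) i (u' @ v') = None \<or>
        fop (tensor_words \<alpha> Q) i (u @ v) = map_option (\<lambda>z. z @ v) (fop (tensor_words \<alpha> Q) i u) \<and>
        fop (tensor_words \<alpha> Q) i (u' @ v') = map_option (\<lambda>z. z @ v') (fop (tensor_words \<alpha> Q) i u') \<or>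
        fop (tensor_words \<alpha> Q) i (u @ v) = map_option (\<lambda>z. u @ z) (fop (tensor_words \<alpha> Q) i v) \<and>
        fop (tensor_words \<alpha> Q) i (u' @ v') = map_option (\<lambda>z. u' @ z) (fop (tensor_words \<alpha> Q) i v')"
      using sig * by (simp add: tensor_words_def ten_append_f in_lists_conv_set)
  qed
qed

text \<open>The infinite clause is decided by the same data and leads to the first alternative of
  \<open>append_e\<close> and \<open>append_f\<close>.\<close>

lemma word_qcrystal_qtensor_words: "word_qcrystal (qtensor_words \<alpha> Q)"
proof -
  interpret regular_qcrystal "qtensor_words \<alpha> Q" by (rule regular_qtensor_words)
  show ?thesis
  proof
    fix u u' v v' i
    show "length v = length u"
      if "u \<in> elems (qtensor_words \<alpha> Q)" "eop (qtensor_words \<alpha> Q) i u = Some v"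
      using that qten_e_Some[of u i v] by (simp add: qtensor_words_def)
    show "length v = length u"
      if "u \<in> elems (qtensor_words \<alpha> Q)" "fop (qtensor_words \<alpha> Q) i u = Some v"
      using that qten_f_Some[of u i v] by (simp add: qtensor_words_def)
    assume "same_signature (qtensor_words \<alpha> Q) u u'" "same_signature (qtensor_words \<alpha> Q) v v'"
    note sig = this[unfolded same_signature_def qtensor_words_def, simplified]
    have *: "\<forall>x\<in>set u. x \<in> elems Q" "\<forall>x\<in>set v. x \<in> elems Q"
      "\<forall>x\<in>set u'. x \<in> elems Q" "\<forall>x\<in>set v'. x \<in> elems Q"
      using sig by auto
    show "same_signature (qtensor_words \<alpha> Q) (u @ v) (u' @ v')"
      using sig * by (auto simp: same_signature_def qtensor_words_def qten_append_eps qten_append_phi in_lists_conv_set)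
    show "eop (qtensor_words \<alpha> Q) i (u @ v) = None \<and> eop (qtensor_words \<alpha> Q) i (u' @ v') = None \<or>
        eop (qtensor_words \<alpha> Q) i (u @ v) = map_option (\<lambda>z. z @ v) (eop (qtensor_words \<alpha> Q) i u) \<and>
        eop (qtensor_words \<alpha> Q) i (u' @ v') = map_option (\<lambda>z. z @ v') (eop (qtensor_words \<alpha> Q) i u') \<or>
        eop (qtensor_words \<alpha> Q) i (u @ v) = map_option (\<lambda>z. u @ z) (eop (qtensor_words \<alpha> Q) i v) \<and>
        eop (qtensor_words \<alpha> Q) i (u' @ v') = map_option (\<lambda>z. u' @ z) (eop (qtensor_words \<alpha> Q) i v')"
      using sig * by (simp add: qtensor_words_def qten_append_e in_lists_conv_set)
    show "fop (qtensor_words \<alpha> Q) i (u @ v) = None \<and> fop (qtensor_words \<alpha> Q) i (u' @ v') = None \<or>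
        fop (qtensor_words \<alpha> Q) i (u @ v) = map_option (\<lambda>z. z @ v) (fop (qtensor_words \<alpha> Q) i u) \<and>
        fop (qtensor_words \<alpha> Q) i (u' @ v') = map_option (\<lambda>z. z @ v') (fop (qtensor_words \<alpha> Q) i u') \<or>
        fop (qtensor_words \<alpha> Q) i (u @ v) = map_option (\<lambda>z. u @ z) (fop (qtensor_words \<alpha> Q) i v) \<and>
        fop (qtensor_words \<alpha> Q) i (u' @ v') = map_option (\<lambda>z. u' @ z) (fop (qtensor_words \<alpha> Q) i v')"
      using sig * by (simp add: qtensor_words_def qten_append_f in_lists_conv_set)
  qed
qed

end

section \<open>Linearly independent weights\<close>

locale independent_quasi_crystal = seminormal_quasi_crystal \<Phi> \<alpha> \<Lambda> Q
  for \<Phi> :: "'v::euclidean_space set"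
    and \<alpha> :: "'i::finite \<Rightarrow> 'v"
    and \<Lambda> :: "'v set"
    and Q :: "('q, 'i, 'v) qcrystal" +
  assumes independent_weights: "independent (wt Q ` elems Q)"
begin

section \<open>Coordinates with respect to the letter weights\<close>

abbreviation "coord \<equiv> representation (wt Q ` elems Q)"

lemma coord_wt: "x \<in> elems Q \<Longrightarrow> coord (wt Q x) b = (if wt Q x = b then 1 else 0)"
  by (simp add: representation_basis[OF independent_weights])

lemma coord_add:
  assumes "v \<in> span (wt Q ` elems Q)" "w \<in> span (wt Q ` elems Q)"
  shows "coord (v + w) b = coord v b + coord w b"
  by (simp add: representation_add[OF independent_weights assms(2,1)])

lemma wt_in_span: "x \<in> elems Q \<Longrightarrow> wt Q x \<in> span (wt Q ` elems Q)"
  by (simp add: span_base)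

lemma word_wt_in_span: "w \<in> lists (elems Q) \<Longrightarrow> word_wt Q w \<in> span (wt Q ` elems Q)"
  by (induction w rule: list.induct) (auto intro: span_add wt_in_span span_zero)

text \<open>Through this, the number of letters of a given weight depends only on the weight of the
  word.\<close>

lemma coord_word_wt:
  "w \<in> lists (elems Q) \<Longrightarrow> coord (word_wt Q w) b = real (length (filter (\<lambda>x. wt Q x = b) w))"
  by (induction w rule: list.induct)
    (auto simp: representation_zero coord_add wt_in_span word_wt_in_span coord_wt)

text \<open>Both differences \<open>wt Q y - wt Q x\<close> and \<open>wt Q y' - wt Q x'\<close>
  equal \<open>\<alpha> i\<close>. After clearing signs, the coordinate at \<open>wt Q x\<close> is
  at least 1 on the side of \<open>x\<close>; as \<open>y\<close> has another weight, only
  \<open>x'\<close> can supply it on the other side.\<close>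

lemma wt_eop_unique:
  assumes "x \<in> elems Q" "x' \<in> elems Q" "eop Q i x = Some y" "eop Q i x' = Some y'"
  shows "wt Q x' = wt Q x"
proof -
  note y = letter_e_Some(1,2)[OF assms(1,3)] and y' = letter_e_Some(1,2)[OF assms(2,4)]
  have "wt Q y + wt Q x' = wt Q y' + wt Q x" by (simp add: y y')
  then have "coord (wt Q y) (wt Q x) + coord (wt Q x') (wt Q x)
      = coord (wt Q y') (wt Q x) + coord (wt Q x) (wt Q x)"
    using assms(1,2) y(1) y'(1) by (metis coord_add wt_in_span)
  moreover have "wt Q y \<noteq> wt Q x"
    using simple_root[of i] zero_not_root by (auto simp: y(2))
  ultimately show ?thesis
    using assms(1,2) y(1) y'(1) by (simp add: coord_wt split: if_splits)
qed

text \<open>Otherwise \<open>x\<close> and \<open>y\<close> would have the same weight by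
  \<open>wt_eop_unique\<close>, although these weights differ by a root.\<close>

lemma eop_eop_None:
  assumes "x \<in> elems Q" "eop Q i x = Some y"
  shows "eop Q i y = None"
proof (rule ccontr)
  assume "eop Q i y \<noteq> None"
  then obtain z where "eop Q i y = Some z" by blast
  then have "wt Q y = wt Q x"
    using wt_eop_unique[OF assms(1) letter_e_Some(1)[OF assms] assms(2)] by blast
  then show False
    using letter_e_Some(2)[OF assms] simple_root[of i] zero_not_root by simp
qed

text \<open>Strings have at most one edge by \<open>eop_eop_None\<close>, so \<open>eps\<close> and
  \<open>phi\<close> are at most 1 and not both 1. The pairing is their difference.\<close>

lemma letter_cases:
  assumes x: "x \<in> elems Q" and fin: "eps Q i x \<noteq> Pinf"
  obtains (zero) "eps Q i x = Fin 0" "phi Q i x = Fin 0" "eop Q i x = None"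
      "pairing (wt Q x) (\<alpha> i) = 0"
    | (minus) "eps Q i x = Fin 1" "phi Q i x = Fin 0" "eop Q i x \<noteq> None"
      "pairing (wt Q x) (\<alpha> i) = -1"
    | (plus) "eps Q i x = Fin 0" "phi Q i x = Fin 1" "eop Q i x = None"
      "pairing (wt Q x) (\<alpha> i) = 1"
proof -
  have e: "eps Q i z = Fin 1 \<and> phi Q i z = Fin 0" if z: "z \<in> elems Q" "eop Q i z = Some y" for z y
  proof -
    note y = letter_e_Some[OF z]
    have "eps Q i y = Fin 0"
      using letter_None(1)[OF y(1), of i] eop_eop_None[OF z] y(8) by simp
    then have "eps Q i z = Fin 1" using y(5) by simp
    \<comment> \<open>From a value of \<open>fop\<close> at \<open>z\<close>, \<open>eop\<close>
      could be applied twice in a row.\<close>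
    moreover have "fop Q i z = None"
      using eop_eop_None letter_f_Some[OF z(1)] z(2) by (metis not_None_eq option.distinct(1))
    then have "phi Q i z = Fin 0" using letter_None(2)[OF z(1), of i] y(9) by simp
    ultimately show ?thesis by simp
  qed
  note facts = letter_facts(1-3)[OF x, of i]
  show ?thesis
  proof (cases "eop Q i x")
    case (Some y)
    then show ?thesis using e[OF x] facts(3) by (intro minus) auto
  next
    case None
    then have eps: "eps Q i x = Fin 0" using letter_None(1)[OF x, of i] fin by simp
    show ?thesis
    proof (cases "fop Q i x")
      case None
      then have "phi Q i x = Fin 0" using letter_None(2)[OF x, of i] eps facts(3) by simp
      then show ?thesis using \<open>eop Q i x = None\<close> eps facts(3) by (intro zero) auto
    next
      case (Some z)
      note z = letter_f_Some[OF x Some]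
      have "phi Q i x = Fin 1" using letter_e_Some(6)[OF z] e[OF z] by simp
      then show ?thesis using \<open>eop Q i x = None\<close> eps facts(3) by (intro plus) auto
    qed
  qed
qed

text \<open>A word without letters of infinite \<open>eps\<close> is a sequence of signs, where the minus signs are
  the letters on which \<open>eop\<close> is defined; \<open>ten_eps\<close> counts the minus signs left after cancelling
  factors \<open>+-\<close>, and \<open>qten_eps\<close> is finite exactly when nothing cancels.\<close>

lemma qten_eq_ten:
  fixes i
  assumes "w \<in> lists (elems Q)"
  defines "n \<equiv> \<lambda>w. int (length (filter (\<lambda>x. eop Q i x \<noteq> None) w))"
  shows "(ten_eps \<alpha> Q i w = Pinf \<longrightarrow> qten_eps \<alpha> Q i w = Pinf) \<and>
    (ten_eps \<alpha> Q i w \<noteq> Pinf \<longrightarrow> ten_eps \<alpha> Q i w \<le> Fin (n w) \<and>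
       qten_eps \<alpha> Q i w = (if ten_eps \<alpha> Q i w = Fin (n w) then Fin (n w) else Pinf)) \<and>
    (qten_eps \<alpha> Q i w \<noteq> Pinf \<longrightarrow>
       qten_e \<alpha> Q i w = ten_e \<alpha> Q i w \<and> qten_f \<alpha> Q i w = ten_f \<alpha> Q i w)"
  using assms(1)
proof (induction w rule: list.induct)
  case Nil
  then show ?case by (simp add: n_def)
next
  case (Cons x w)
  then have x: "x \<in> elems Q" and w: "w \<in> lists (elems Q)" by auto
  note IH = Cons.IH[OF w] and facts = ten_facts[OF w, of i] qten_facts[OF w, of i]
  have n: "n (x # w) = (if eop Q i x \<noteq> None then n w + 1 else n w)" "n w \<ge> 0"
    by (simp_all add: n_def)
  show ?case
  proof (cases "eps Q i x = Pinf")
    case True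
    then show ?thesis
      using letter_facts(3)[OF x, of i] facts
      by (cases "qten_eps \<alpha> Q i w") (auto simp: ten_Cons[OF x] qten_Cons[OF x] max_def)
  next
    case False
    \<comment> \<open>A zero letter changes neither \<open>ten_eps\<close> nor the count, and a
      minus letter adds one to both. For a plus letter and finite \<open>ten_eps\<close> of
      \<open>w\<close>, equality survives exactly if \<open>w\<close> has no minus letter, which is
      when the infinite clause does not apply.\<close>
    from x False show ?thesis
      by (cases rule: letter_cases)
        (use IH facts n in \<open>cases "ten_eps \<alpha> Q i w";
          auto simp: ten_Cons[OF x] qten_Cons[OF x] max_def split: if_splits\<close>)+
  qed
qed

section \<open>Letter counts determined by the weight\<close>

lemma eps_letter_finite:
  assumes "w \<in> lists (elems Q)" "ten_eps \<alpha> Q i w \<noteq> Pinf" "x \<in> set w"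
  shows "eps Q i x \<noteq> Pinf"
  using assms
proof (induction w rule: list.induct)
  case (Cons y w)
  then have y: "y \<in> elems Q" and w: "w \<in> lists (elems Q)" by auto
  have "eps Q i y \<noteq> Pinf" "ten_eps \<alpha> Q i w \<noteq> Pinf"
    using Cons.prems(2) by (cases "eps Q i y"; cases "ten_eps \<alpha> Q i w"; auto simp: ten_Cons[OF y])+
  then show ?case using Cons.IH[OF w] Cons.prems(3) by auto
qed simp

text \<open>Among letters of finite \<open>eps\<close>, those on which \<open>eop Q i\<close> acts
  are exactly those with the weight of one such letter \<open>z\<close>, and coordinates count them.
  Finiteness matters: a letter with infinite \<open>eps\<close> may have that weight while
  \<open>eop Q i\<close> is undefined on it.\<close>

lemma count_eop_eq:
  assumes u: "u \<in> lists (elems Q)" "ten_eps \<alpha> Q i u \<noteq> Pinf"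
    and v: "v \<in> lists (elems Q)" "ten_eps \<alpha> Q i v \<noteq> Pinf"
    and wt: "word_wt Q u = word_wt Q v"
  shows "length (filter (\<lambda>x. eop Q i x \<noteq> None) u) = length (filter (\<lambda>x. eop Q i x \<noteq> None) v)"
proof (cases "\<exists>z \<in> elems Q. eop Q i z \<noteq> None")
  case True
  then obtain z y where z: "z \<in> elems Q" "eop Q i z = Some y" by blast
  \<comment> \<open>Of the three kinds of letters with finite \<open>eps\<close>, only minus letters
    have pairing -1, so having the weight of \<open>z\<close> forces \<open>eop\<close> to be
    defined.\<close>
  have z_pairing: "pairing (wt Q z) (\<alpha> i) = -1"
    using z(1) letter_e_Some(7)[OF z] by (cases rule: letter_cases) (use z in auto)
  have "filter (\<lambda>x. eop Q i x \<noteq> None) w = filter (\<lambda>x. wt Q x = wt Q z) w"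
    if w: "w \<in> lists (elems Q)" "ten_eps \<alpha> Q i w \<noteq> Pinf" for w
  proof (rule filter_cong)
    fix x assume "x \<in> set w"
    then have x: "x \<in> elems Q" "eps Q i x \<noteq> Pinf" using w eps_letter_finite by auto
    then show "eop Q i x \<noteq> None \<longleftrightarrow> wt Q x = wt Q z"
      by (cases rule: letter_cases) (use wt_eop_unique[OF z(1) x(1) z(2)] z_pairing in auto)
  qed simp
  then show ?thesis
    using coord_word_wt[OF u(1), of "wt Q z"] coord_word_wt[OF v(1), of "wt Q z"] wt u v by simp
next
  case False
  then show ?thesis using u v by (auto simp: filter_empty_conv)
qed

text \<open>A bisimulation is not tied to a component, so the components of the two structures need
  not be compared. Equal weights give equal letter counts and hence equal \<open>qten_eps\<close>.
  Where this value is finite the operators are those of the tensor structure, and elsewhere they are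
  undefined on both sides.\<close>

lemma bisimulation_qtensor_words:
  assumes R: "bisimulation (tensor_words \<alpha> Q) R"
  shows "bisimulation (qtensor_words \<alpha> Q) R"
proof -
  have *: "qten_eps \<alpha> Q i u = qten_eps \<alpha> Q i v \<and> qten_phi \<alpha> Q i u = qten_phi \<alpha> Q i v \<and>
      rel_option R (qten_e \<alpha> Q i u) (qten_e \<alpha> Q i v) \<and>
      rel_option R (qten_f \<alpha> Q i u) (qten_f \<alpha> Q i v)"
    if "R u v" for u v i
  proof -
    note D = bisimulationD[OF R that, unfolded tensor_words_def, simplified]
    have u: "u \<in> lists (elems Q)" and v: "v \<in> lists (elems Q)" using D by auto
    note facts = qten_facts[OF u, of i] qten_facts[OF v, of i]
    have eps: "qten_eps \<alpha> Q i u = qten_eps \<alpha> Q i v"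
    proof (cases "ten_eps \<alpha> Q i u = Pinf")
      case True
      then show ?thesis using qten_eq_ten[OF u, of i] qten_eq_ten[OF v, of i] D(4)[of i] by simp
    next
      case False
      then show ?thesis
        using qten_eq_ten[OF u, of i] qten_eq_ten[OF v, of i] D(3) D(4)[of i]
          count_eop_eq[OF u False v] by simp
    qed
    moreover have "qten_phi \<alpha> Q i u = qten_phi \<alpha> Q i v" using facts eps D(3) by simp
    moreover have "rel_option R (qten_e \<alpha> Q i u) (qten_e \<alpha> Q i v) \<and>
        rel_option R (qten_f \<alpha> Q i u) (qten_f \<alpha> Q i v)"
    proof (cases "qten_eps \<alpha> Q i u = Pinf")
      case True
      then show ?thesis using facts eps by simp
    next
      case False
      then show ?thesis
        using qten_eq_ten[OF u, of i] qten_eq_ten[OF v, of i] eps D(6,7)[of i] by simp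
    qed
    ultimately show ?thesis by blast
  qed
  have "bi_unique R" using R by (simp add: bisimulation_def)
  moreover have "u \<in> elems (qtensor_words \<alpha> Q) \<and> v \<in> elems (qtensor_words \<alpha> Q) \<and>
      wt (qtensor_words \<alpha> Q) u = wt (qtensor_words \<alpha> Q) v" if "R u v" for u v
    using bisimulationD(1-3)[OF R that] by (simp add: tensor_words_def qtensor_words_def)
  ultimately show ?thesis
    using * unfolding bisimulation_def by (simp add: qtensor_words_def)
qed

lemma plactic_subset_hypoplactic: "plactic_rel \<alpha> Q \<subseteq> hypoplactic_rel \<alpha> Q"
proof (rule subrelI)
  interpret T: regular_qcrystal "tensor_words \<alpha> Q" by (rule regular_tensor_words)
  interpret H: regular_qcrystal "qtensor_words \<alpha> Q" by (rule regular_qtensor_words)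
  fix u v assume "(u, v) \<in> plactic_rel \<alpha> Q"
  then obtain R where "bisimulation (tensor_words \<alpha> Q) R" "R u v"
    unfolding plactic_rel_def by (rule T.bisimulation_if_component_iso)
  then show "(u, v) \<in> hypoplactic_rel \<alpha> Q"
    unfolding hypoplactic_rel_def
    by (intro H.component_iso_if_bisimulation bisimulation_qtensor_words)
qed

end

section \<open>Quotient monoids\<close>

locale monoid_congruence = Group.monoid M for M (structure) +
  fixes r
  assumes equiv: "equiv (carrier M) r"
    and congruence: "(a, a') \<in> r \<Longrightarrow> (b, b') \<in> r \<Longrightarrow> (a \<otimes> b, a' \<otimes> b') \<in> r"
begin

lemma class_mult:
  assumes "a \<in> carrier M" "b \<in> carrier M"
  shows "r `` {a} \<otimes>\<^bsub>quotient_monoid M r\<^esub> r `` {b} = r `` {a \<otimes> b}"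
proof -
  have "r `` {x \<otimes> y} = r `` {a \<otimes> b}" if "(a, x) \<in> r" "(b, y) \<in> r" for x y
    using equiv_class_eq[OF equiv congruence[OF that]] by simp
  \<comment> \<open>Reflexivity makes the union nonempty; without a member it would not equal the
    class.\<close>
  moreover have "(a, a) \<in> r" "(b, b) \<in> r" using equiv assms by (auto simp: equiv_def refl_on_def)
  ultimately have "(\<Union>x\<in>r `` {a}. \<Union>y\<in>r `` {b}. r `` {x \<otimes> y}) = r `` {a \<otimes> b}" by blast
  then show ?thesis by (simp add: quotient_monoid_def)
qed

lemma class_carrier: "carrier (quotient_monoid M r) = (\<lambda>a. r `` {a}) ` carrier M"
  by (auto simp: quotient_monoid_def quotient_def)

lemma class_one: "\<one>\<^bsub>quotient_monoid M r\<^esub> = r `` {\<one>}"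
  by (simp add: quotient_monoid_def)

lemma monoid_quotient_monoid: "Group.monoid (quotient_monoid M r)"
  by (rule Group.monoidI) (auto simp: class_carrier class_one class_mult m_assoc)

end

text \<open>As \<open>r\<close> is contained in \<open>s\<close>, the \<open>s\<close>-image of an
  \<open>r\<close>-class is a single \<open>s\<close>-class. So \<open>\<theta>\<close> is the map
  induced by the identity of \<open>M\<close>, given without a choice of representatives.\<close>

lemma quotient_monoid_projection:
  assumes "monoid_congruence M r" "monoid_congruence M s" "r \<subseteq> s"
  defines "\<theta> \<equiv> \<lambda>X. s `` X"
  shows "a \<in> carrier M \<Longrightarrow> \<theta> (r `` {a}) = s `` {a}"
    and "\<theta> \<in> hom (quotient_monoid M r) (quotient_monoid M s)"
    and "\<theta> \<one>\<^bsub>quotient_monoid M r\<^esub> = \<one>\<^bsub>quotient_monoid M s\<^esub>"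
    and "\<theta> ` carrier (quotient_monoid M r) = carrier (quotient_monoid M s)"
proof -
  interpret r: monoid_congruence M r by fact
  interpret s: monoid_congruence M s by fact
  show on_class: "\<theta> (r `` {a}) = s `` {a}" if "a \<in> carrier M" for a
  proof -
    have "(a, a) \<in> r" using r.equiv that by (auto simp: equiv_def refl_on_def)
    moreover have "s `` {b} = s `` {a}" if "(a, b) \<in> r" for b
      using equiv_class_eq[OF s.equiv, of a b] that assms(3) by auto
    ultimately show ?thesis unfolding \<theta>_def by blast
  qed
  show "\<theta> \<in> hom (quotient_monoid M r) (quotient_monoid M s)"
    by (rule homI) (auto simp: r.class_carrier s.class_carrier r.class_mult s.class_mult on_class)
  show "\<theta> \<one>\<^bsub>quotient_monoid M r\<^esub> = \<one>\<^bsub>quotient_monoid M s\<^esub>"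
    by (simp add: r.class_one s.class_one on_class)
  show "\<theta> ` carrier (quotient_monoid M r) = carrier (quotient_monoid M s)"
    by (simp add: r.class_carrier s.class_carrier image_image on_class)
qed

lemma monoid_free_monoid: "Group.monoid (free_monoid A)"
  by (rule Group.monoidI) (auto simp: free_monoid_def)

lemma (in word_qcrystal) monoid_congruence_component_iso_rel:
  assumes "elems W = lists A"
  shows "monoid_congruence (free_monoid A) (component_iso_rel W)"
proof (intro monoid_congruence.intro monoid_congruence_axioms.intro)
  show "Group.monoid (free_monoid A)" by (rule monoid_free_monoid)
  show "equiv (carrier (free_monoid A)) (component_iso_rel W)"
    using equiv_component_iso_rel by (simp add: assms free_monoid_def)
qed (simp add: free_monoid_def component_iso_rel_append)

theorem proposition6p2:
  fixes \<Phi> :: "'v::euclidean_space set"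
    and \<alpha> :: "'i::finite \<Rightarrow> 'v"
    and \<Lambda> :: "'v set"
    and Q :: "('q, 'i, 'v) qcrystal"
  assumes "seminormal_quasi_crystal \<Phi> \<alpha> \<Lambda> Q"
    and "independent {wt Q x | x. x \<in> elems Q}"
  shows "plactic_rel \<alpha> Q \<subseteq> hypoplactic_rel \<alpha> Q \<and>
    Group.monoid (plac \<alpha> Q) \<and> Group.monoid (hypo \<alpha> Q) \<and>
    (\<exists>\<theta> \<in> hom (plac \<alpha> Q) (hypo \<alpha> Q).
       \<theta> \<one>\<^bsub>plac \<alpha> Q\<^esub> = \<one>\<^bsub>hypo \<alpha> Q\<^esub> \<and>
       \<theta> ` carrier (plac \<alpha> Q) = carrier (hypo \<alpha> Q) \<and>
       (\<forall>u \<in> lists (elems Q). \<theta> (plactic_rel \<alpha> Q `` {u}) = hypoplactic_rel \<alpha> Q `` {u}))"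
proof -
  interpret independent_quasi_crystal \<Phi> \<alpha> \<Lambda> Q
    using assms by (simp add: independent_quasi_crystal_def independent_quasi_crystal_axioms_def
      Setcompr_eq_image)
  have p: "monoid_congruence (free_monoid (elems Q)) (plactic_rel \<alpha> Q)"
    unfolding plactic_rel_def
    by (rule word_qcrystal.monoid_congruence_component_iso_rel[OF word_qcrystal_tensor_words])
      (simp add: tensor_words_def)
  have h: "monoid_congruence (free_monoid (elems Q)) (hypoplactic_rel \<alpha> Q)"
    unfolding hypoplactic_rel_def
    by (rule word_qcrystal.monoid_congruence_component_iso_rel[OF word_qcrystal_qtensor_words])
      (simp add: qtensor_words_def)
  note proj = quotient_monoid_projection[OF p h plactic_subset_hypoplactic]
  show ?thesis
    unfolding plac_def hypo_def
  \<comment> \<open>The witness is the \<open>\<theta>\<close> of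
    \<open>quotient_monoid_projection\<close>: it saturates a plactic class under the hypoplactic
    congruence.\<close>
  proof (intro conjI bexI[of _ "\<lambda>X. hypoplactic_rel \<alpha> Q `` X"] ballI)
    fix u assume "u \<in> lists (elems Q)"
    then show "hypoplactic_rel \<alpha> Q `` (plactic_rel \<alpha> Q `` {u}) = hypoplactic_rel \<alpha> Q `` {u}"
      by (intro proj(1)) (simp add: free_monoid_def)
  qed (rule plactic_subset_hypoplactic proj(2-4) monoid_congruence.monoid_quotient_monoid p h)+
qed

end
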